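(* The union of the network classes $\mathcal{N}_{1},\mathcal{N}_2,\mathcal{N}_3,\mathcal{N}_{4}$, $\mathcal{N}_{6},\mathcal{N}_7,\mathcal{N}_8,\mathcal{N}_{9}$, $\mathcal{N}_{10}^{i},\mathcal{N}_{11}^{i},\mathcal{N}_{12}^{i},\mathcal{N}_{13}^{i},\mathcal{N}_{14}^{i}$ and $\mathcal{N}_{10}^{d},\mathcal{N}_{11}^{d},\mathcal{N}_{12}^{d},\mathcal{N}_{13}^{d},\mathcal{N}_{14}^{d}$ is a generating set for $\mathcal{Z}_{2,1}$.
   Context: **Networks.** One-port networks are built from resistors (impedance $R$), inductors (impedance $Ls$, $L>0$) and capacitors (impedance $1/(Cs)$, $C>0$). A single element is a series-parallel network, and a series or parallel connection of two series-parallel networks is a series-parallel network. A series connection of networks with impedances $Z_1,Z_2$ has impedance $Z_1+Z_2$; a parallel connection has impedance $Z$ with $1/Z=1/Z_1+1/Z_2$, written $Z_1\parallel Z_2$. An expression built with $+$ and $\parallel$ describes the network with the corresponding series and parallel connections. A resistor with resistance $R=0$ is a short circuit, and a resistor with conductance $G=0$ (written $1/G$) is an open circuit. Energy storage elements are the inductors and capacitors. **Transformations.** For a series-parallel network $N$ with impedance $Z(s)$: $N^{i}$ is obtained by replacing inductors with impedance $Xs$ by capacitors with impedance $X/s$ and vice versa (impedance $Z(1/s)$); $N^{d}$ is obtained by interchanging series and parallel connections and inverting the impedance of each element (impedance $1/Z(s)$). For a class $\mathcal{N}$, $\mathcal{N}^{i}=\{N^{i}: N\in\mathcal{N}\}$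 and $\mathcal{N}^{d}=\{N^{d}: N\in\mathcal{N}\}$. **Generating sets.** $\mathcal{Z}_{m,n}$ is the set of impedances of series-parallel networks containing at most $m$ capacitors and at most $n$ inductors. $\mathcal{G}$ is a generating set for $\mathcal{Z}_{m,n}$ if (i) $\mathcal{G}$ is a set of series-parallel networks, each containing at most $m+n$ energy storage elements, and (ii) for every $Z\in\mathcal{Z}_{m,n}$ there is a network in $\mathcal{G}$ whose impedance is $Z$. **Network classes.** $\mathcal{N}_k$ is the set of all networks of the form $N_k$ with parameters satisfying: all $R_j\ge 0$, all $G_j\ge 0$, all $C_j,L_j>0$, and additionally $R_2>0$ in $N_4$ and $N_{14}$. - $N_1$: $R_1$. - $N_2$: $R_1+\left(\frac1{G_2}\parallel\frac1{C_1s}\right)$. - $N_3$: $R_1+\left(\frac1{G_2}\parallel L_1s\right)$. - $N_4$: $R_1+\left(\frac1{C_2s}\parallel\left(R_2+\left(\frac1{G_3}\parallel\frac1{C_1s}\right)\right)\right)$. - $N_6$: $R_1+\left(L_1s\parallel\left(R_2+\left(\frac1{G_3}\parallel\frac1{C_1s}\right)\right)\right)$. - $N_7$: $R_1+\left(\frac1{C_1s}\parallel\left(R_2+\left(\frac1{G_3}\parallel L_1s\right)\right)\right)$. - $N_8$: $\frac1{G_1}\parallel\left(\frac1{C_1s}+\left(\frac1{G_2}\parallel(R_3+L_1s)\right)\right)$. - $N_9$: $\frac1{G_1}\parallel\left(L_1s+\left(\frac1{G_2}\parallel\left(R_3+\frac1{C_1s}\right)\right)\right)$. - $N_{10}$: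 $R_4+\left[(R_5+L_2s)\parallel\left(R_1+\left(L_1s\parallel\left(R_2+\left(\frac1{G_3}\parallel\frac1{C_1s}\right)\right)\right)\right)\right]$. - $N_{11}$: $R_4+\left[(R_5+L_2s)\parallel\left(R_1+\left(\frac1{C_1s}\parallel\left(R_2+\left(\frac1{G_3}\parallel L_1s\right)\right)\right)\right)\right]$. - $N_{12}$: $R_4+\left[(R_5+L_2s)\parallel\frac1{G_1}\parallel\left(\frac1{C_1s}+\left(\frac1{G_2}\parallel(R_3+L_1s)\right)\right)\right]$. - $N_{13}$: $R_4+\left[(R_5+L_2s)\parallel\frac1{G_1}\parallel\left(L_1s+\left(\frac1{G_2}\parallel\left(R_3+\frac1{C_1s}\right)\right)\right)\right]$. - $N_{14}$: $R_4+\left[\left(R_5+\frac1{C_1s}\right)\parallel\left(R_1+\left(L_2s\parallel\left(R_2+\left(\frac1{G_3}\parallel L_1s\right)\right)\right)\right)\right]$. *)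

theory Defs
  imports "HOL-Computational_Algebra.Computational_Algebra"
begin

text \<open>
  An impedance is a real rational function in \<open>s\<close>, or infinite in the case of an open circuit,
  which is represented by \<^term>\<open>None\<close>.
\<close>

type_synonym impedance = "real poly fract option"

fun reciprocal :: "impedance \<Rightarrow> impedance" where
  "reciprocal None = Some 0"
| "reciprocal (Some z) = (if z = 0 then None else Some (1 / z))"

fun series_imp :: "impedance \<Rightarrow> impedance \<Rightarrow> impedance" where
  "series_imp (Some z) (Some w) = Some (z + w)"
| "series_imp _ _ = None"

definition parallel_imp :: "impedance \<Rightarrow> impedance \<Rightarrow> impedance" where
  "parallel_imp z w = reciprocal (series_imp (reciprocal z) (reciprocal w))"

text \<open>
  A resistor may be given by its resistance \<open>R\<close> (impedance \<open>R\<close>) or by its conductance \<open>G\<close>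
  (impedance \<open>1/G\<close>), so that \<open>Resistor 0\<close> is a short circuit and \<open>Conductor 0\<close> an open circuit.
  The parameters of \<open>Inductor\<close> and \<open>Capacitor\<close> are the inductance \<open>L\<close> and the capacitance \<open>C\<close>.
\<close>

datatype network =
    Resistor real
  | Conductor real
  | Inductor real
  | Capacitor real
  | Series network network (infixl \<open>\<oplus>\<close> 65)
  | Parallel network network (infixl \<open>\<parallel>\<close> 70)

fun series_parallel :: "network \<Rightarrow> bool" where
  "series_parallel (Resistor R) \<longleftrightarrow> R \<ge> 0"
| "series_parallel (Conductor G) \<longleftrightarrow> G \<ge> 0"
| "series_parallel (Inductor L) \<longleftrightarrow> L > 0"
| "series_parallel (Capacitor C) \<longleftrightarrow> C > 0"
| "series_parallel (M \<oplus> N) \<longleftrightarrow> series_parallel M \<and> series_parallel N"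
| "series_parallel (M \<parallel> N) \<longleftrightarrow> series_parallel M \<and> series_parallel N"

fun impedance :: "network \<Rightarrow> impedance" where
  "impedance (Resistor R) = Some (Fract [:R:] 1)"
| "impedance (Conductor G) = reciprocal (Some (Fract [:G:] 1))"
| "impedance (Inductor L) = Some (Fract [:0, L:] 1)"
| "impedance (Capacitor C) = Some (1 / Fract [:0, C:] 1)"
| "impedance (M \<oplus> N) = series_imp (impedance M) (impedance N)"
| "impedance (M \<parallel> N) = parallel_imp (impedance M) (impedance N)"

fun num_capacitors :: "network \<Rightarrow> nat" where
  "num_capacitors (Capacitor C) = 1"
| "num_capacitors (M \<oplus> N) = num_capacitors M + num_capacitors N"
| "num_capacitors (M \<parallel> N) = num_capacitors M + num_capacitors N"
| "num_capacitors _ = 0"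

fun num_inductors :: "network \<Rightarrow> nat" where
  "num_inductors (Inductor L) = 1"
| "num_inductors (M \<oplus> N) = num_inductors M + num_inductors N"
| "num_inductors (M \<parallel> N) = num_inductors M + num_inductors N"
| "num_inductors _ = 0"

definition num_storage :: "network \<Rightarrow> nat" where
  "num_storage N = num_capacitors N + num_inductors N"

text \<open>
  Frequency inversion: the impedance \<open>X s\<close> becomes \<open>X / s\<close>, which is that of a
  capacitor with \<open>C = 1 / X\<close>, and conversely.
\<close>

fun freq_inv :: "network \<Rightarrow> network" where
  "freq_inv (Resistor R) = Resistor R"
| "freq_inv (Conductor G) = Conductor G"
| "freq_inv (Inductor L) = Capacitor (1 / L)"
| "freq_inv (Capacitor C) = Inductor (1 / C)"
| "freq_inv (M \<oplus> N) = freq_inv M \<oplus> freq_inv N"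
| "freq_inv (M \<parallel> N) = freq_inv M \<parallel> freq_inv N"

text \<open>Duality: an inductor of impedance \<open>L s\<close> becomes a capacitor of impedance \<open>1 / (L s)\<close>.\<close>

fun dual :: "network \<Rightarrow> network" where
  "dual (Resistor R) = Conductor R"
| "dual (Conductor G) = Resistor G"
| "dual (Inductor L) = Capacitor L"
| "dual (Capacitor C) = Inductor C"
| "dual (M \<oplus> N) = dual M \<parallel> dual N"
| "dual (M \<parallel> N) = dual M \<oplus> dual N"

lemma reciprocal_reciprocal [simp]: "reciprocal (reciprocal z) = z"
  by (cases z) auto

lemma Fract_1_eq_0_iff: "Fract p 1 = 0 \<longleftrightarrow> (p :: real poly) = 0"
  by (simp add: Zero_fract_def eq_fract)

lemma impedance_dual:
  "series_parallel N \<Longrightarrow> impedance (dual N) = reciprocal (impedance N)"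
  by (induction N) (auto simp: parallel_imp_def Fract_1_eq_0_iff)

text \<open>Open circuits (infinite impedance) contribute nothing to the set of impedances below.\<close>

definition impedances :: "nat \<Rightarrow> nat \<Rightarrow> real poly fract set" where
  "impedances m n =
     {Z. \<exists>N. series_parallel N \<and> num_capacitors N \<le> m \<and> num_inductors N \<le> n
             \<and> impedance N = Some Z}"

definition generating_set :: "network set \<Rightarrow> nat \<Rightarrow> nat \<Rightarrow> bool" where
  "generating_set \<G> m n \<longleftrightarrow>
     (\<forall>N\<in>\<G>. series_parallel N \<and> num_storage N \<le> m + n) \<and>
     (\<forall>Z\<in>impedances m n. \<exists>N\<in>\<G>. impedance N = Some Z)"

definition N1 :: "network set" where
  "N1 = {Resistor R1 | R1. R1 \<ge> 0}"

definition N2 :: "network set" where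
  "N2 = {Resistor R1 \<oplus> (Conductor G2 \<parallel> Capacitor C1) | R1 G2 C1.
           R1 \<ge> 0 \<and> G2 \<ge> 0 \<and> C1 > 0}"

definition N3 :: "network set" where
  "N3 = {Resistor R1 \<oplus> (Conductor G2 \<parallel> Inductor L1) | R1 G2 L1.
           R1 \<ge> 0 \<and> G2 \<ge> 0 \<and> L1 > 0}"

definition N4 :: "network set" where
  "N4 = {Resistor R1 \<oplus> (Capacitor C2 \<parallel> (Resistor R2 \<oplus> (Conductor G3 \<parallel> Capacitor C1)))
           | R1 R2 G3 C1 C2.
           R1 \<ge> 0 \<and> R2 > 0 \<and> G3 \<ge> 0 \<and> C1 > 0 \<and> C2 > 0}"

definition N6 :: "network set" where
  "N6 = {Resistor R1 \<oplus> (Inductor L1 \<parallel> (Resistor R2 \<oplus> (Conductor G3 \<parallel> Capacitor C1)))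
           | R1 R2 G3 C1 L1.
           R1 \<ge> 0 \<and> R2 \<ge> 0 \<and> G3 \<ge> 0 \<and> C1 > 0 \<and> L1 > 0}"

definition N7 :: "network set" where
  "N7 = {Resistor R1 \<oplus> (Capacitor C1 \<parallel> (Resistor R2 \<oplus> (Conductor G3 \<parallel> Inductor L1)))
           | R1 R2 G3 C1 L1.
           R1 \<ge> 0 \<and> R2 \<ge> 0 \<and> G3 \<ge> 0 \<and> C1 > 0 \<and> L1 > 0}"

definition N8 :: "network set" where
  "N8 = {Conductor G1 \<parallel> (Capacitor C1 \<oplus> (Conductor G2 \<parallel> (Resistor R3 \<oplus> Inductor L1)))
           | G1 G2 R3 C1 L1.
           G1 \<ge> 0 \<and> G2 \<ge> 0 \<and> R3 \<ge> 0 \<and> C1 > 0 \<and> L1 > 0}"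

definition N9 :: "network set" where
  "N9 = {Conductor G1 \<parallel> (Inductor L1 \<oplus> (Conductor G2 \<parallel> (Resistor R3 \<oplus> Capacitor C1)))
           | G1 G2 R3 C1 L1.
           G1 \<ge> 0 \<and> G2 \<ge> 0 \<and> R3 \<ge> 0 \<and> C1 > 0 \<and> L1 > 0}"

definition N10 :: "network set" where
  "N10 = {Resistor R4 \<oplus>
            ((Resistor R5 \<oplus> Inductor L2) \<parallel>
             (Resistor R1 \<oplus>
               (Inductor L1 \<parallel> (Resistor R2 \<oplus> (Conductor G3 \<parallel> Capacitor C1)))))
            | R1 R2 G3 R4 R5 C1 L1 L2.
            R1 \<ge> 0 \<and> R2 \<ge> 0 \<and> G3 \<ge> 0 \<and> R4 \<ge> 0 \<and> R5 \<ge> 0 \<and> C1 > 0 \<and> L1 > 0 \<and> L2 > 0}"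

definition N11 :: "network set" where
  "N11 = {Resistor R4 \<oplus>
            ((Resistor R5 \<oplus> Inductor L2) \<parallel>
             (Resistor R1 \<oplus>
               (Capacitor C1 \<parallel> (Resistor R2 \<oplus> (Conductor G3 \<parallel> Inductor L1)))))
            | R1 R2 G3 R4 R5 C1 L1 L2.
            R1 \<ge> 0 \<and> R2 \<ge> 0 \<and> G3 \<ge> 0 \<and> R4 \<ge> 0 \<and> R5 \<ge> 0 \<and> C1 > 0 \<and> L1 > 0 \<and> L2 > 0}"

definition N12 :: "network set" where
  "N12 = {Resistor R4 \<oplus>
            ((Resistor R5 \<oplus> Inductor L2) \<parallel>
             Conductor G1 \<parallel>
             (Capacitor C1 \<oplus> (Conductor G2 \<parallel> (Resistor R3 \<oplus> Inductor L1))))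
            | G1 G2 R3 R4 R5 C1 L1 L2.
            G1 \<ge> 0 \<and> G2 \<ge> 0 \<and> R3 \<ge> 0 \<and> R4 \<ge> 0 \<and> R5 \<ge> 0 \<and> C1 > 0 \<and> L1 > 0 \<and> L2 > 0}"

definition N13 :: "network set" where
  "N13 = {Resistor R4 \<oplus>
            ((Resistor R5 \<oplus> Inductor L2) \<parallel>
             Conductor G1 \<parallel>
             (Inductor L1 \<oplus> (Conductor G2 \<parallel> (Resistor R3 \<oplus> Capacitor C1))))
            | G1 G2 R3 R4 R5 C1 L1 L2.
            G1 \<ge> 0 \<and> G2 \<ge> 0 \<and> R3 \<ge> 0 \<and> R4 \<ge> 0 \<and> R5 \<ge> 0 \<and> C1 > 0 \<and> L1 > 0 \<and> L2 > 0}"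

definition N14 :: "network set" where
  "N14 = {Resistor R4 \<oplus>
            ((Resistor R5 \<oplus> Capacitor C1) \<parallel>
             (Resistor R1 \<oplus>
               (Inductor L2 \<parallel> (Resistor R2 \<oplus> (Conductor G3 \<parallel> Inductor L1)))))
            | R1 R2 G3 R4 R5 C1 L1 L2.
            R1 \<ge> 0 \<and> R2 > 0 \<and> G3 \<ge> 0 \<and> R4 \<ge> 0 \<and> R5 \<ge> 0 \<and> C1 > 0 \<and> L1 > 0 \<and> L2 > 0}"

end

theory Submission
  imports Defs
begin

text \<open>
  The field of real rational functions is linearly ordered, with \<open>s\<close> positive and infinitely large,
  and every impedance is nonnegative in this order. A network can therefore be evaluated at any
  \<open>\<sigma> > 0\<close>; frequency inversion becomes \<open>\<sigma> \<mapsto> 1/\<sigma>\<close>, so that an RL class is the corresponding RC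
  class at \<open>1/\<sigma>\<close>, and duality becomes the reciprocal.

  The impedances of networks with one capacitor, with two capacitors, and with one element of each
  kind are exactly the bilinear and biquadratic functions with nonnegative coefficients that satisfy
  certain inequalities involving the \<open>2 \<times> 2\<close> minors of their coefficient matrix. A series resistor
  leaves these minors unchanged, whence the classes are closed under connection with resistors, and
  extracting resistors and reactive elements one by one turns the inequalities into element values.
  A network with two capacitors and one inductor is, up to resistors, a series or parallel connection
  of two networks from these classes; the surplus resistors are absorbed by the smaller classes.
\<close>

text \<open>The order replaces all arguments about poles and zeros: a sum of nonnegative terms
  vanishes only if every term does, so a denominator with nonnegative coefficients never vanishes by
  cancellation, and an open circuit shows up as zero coefficients. Divisions are then justified by
  positivity alone. No inequalities are given for two capacitors and one inductor. That class is
  defined by its form: a resistor in series with a parallel connection of two smaller classes,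
  together with the reciprocals of the mirrored class. The obstacle is closure under a parallel
  resistor, which meets a resistor in series and cannot simply be merged with it. A Moebius identity
  moves it past that series resistor, at the price of rescaling the rest, so the smaller classes
  must also be closed under scaling. Symmetry spares most of the calculations. Parallel connections
  come from series ones by reciprocals, RL from RC by \<sigma> -> 1/\<sigma>, and of the four
  one-capacitor, one-inductor forms only \<open>N6\<close> is realized by hand.\<close>

type_synonym ratfun = "real poly fract"

section \<open>Real constants and the variable in the ordered field\<close>

definition const :: "real \<Rightarrow> ratfun" where
  "const a = Fract [:a:] 1"

definition var :: ratfun where
  "var = Fract [:0, 1:] 1"

lemma const_0 [simp]: "const 0 = 0" and const_1 [simp]: "const 1 = 1"
  by (simp_all add: const_def Zero_fract_def One_fract_def one_pCons)

lemma const_add [simp]: "const (a + b) = const a + const b"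
  and const_diff [simp]: "const (a - b) = const a - const b"
  and const_mult [simp]: "const (a * b) = const a * const b"
  by (simp_all add: const_def mult.commute)

lemma const_le_iff [simp]: "const a \<le> const b \<longleftrightarrow> a \<le> b"
  by (auto simp: const_def less_eq_poly_def pos_poly_pCons)

lemma const_less_iff [simp]: "const a < const b \<longleftrightarrow> a < b"
  by (simp add: less_le_not_le)

lemma const_eq_iff [simp]: "const a = const b \<longleftrightarrow> a = b"
  by (simp add: order_eq_iff)

lemma const_sign_iff [simp]:
  "0 \<le> const a \<longleftrightarrow> 0 \<le> a" "0 < const a \<longleftrightarrow> 0 < a" "const a = 0 \<longleftrightarrow> a = 0"
  using const_le_iff[of 0 a] const_less_iff[of 0 a] const_eq_iff[of a 0] by simp_all

lemma const_divide [simp]: "const (a / b) = const a / const b"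
proof (cases "b = 0")
  case False
  then have "const (a / b) * const b = const a"
    by (simp flip: const_mult)
  with False show ?thesis
    by (simp add: field_simps)
qed simp

lemma var_pos: "0 < var"
proof -
  have "(0 :: real poly) < [:0, 1:]"
    by (simp add: less_poly_def pos_poly_pCons)
  then show ?thesis
    by (simp add: var_def zero_less_Fract_iff)
qed

section \<open>Evaluation of networks and the algebra of impedances\<close>

fun imp_at :: "ratfun \<Rightarrow> network \<Rightarrow> impedance" where
  "imp_at \<sigma> (Resistor R) = Some (const R)"
| "imp_at \<sigma> (Conductor G) = reciprocal (Some (const G))"
| "imp_at \<sigma> (Inductor L) = Some (const L * \<sigma>)"
| "imp_at \<sigma> (Capacitor C) = Some (1 / (const C * \<sigma>))"
| "imp_at \<sigma> (M \<oplus> N) = series_imp (imp_at \<sigma> M) (imp_at \<sigma> N)"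
| "imp_at \<sigma> (M \<parallel> N) = parallel_imp (imp_at \<sigma> M) (imp_at \<sigma> N)"

lemma imp_at_var: "imp_at var N = impedance N"
  by (induction N) (simp_all add: const_def var_def)

lemma imp_at_freq_inv: "imp_at \<sigma> (freq_inv N) = imp_at (1 / \<sigma>) N"
  by (induction N) (simp_all add: field_simps)

lemma imp_at_dual:
  "\<sigma> > 0 \<Longrightarrow> series_parallel N \<Longrightarrow> imp_at \<sigma> (dual N) = reciprocal (imp_at \<sigma> N)"
  by (induction N) (auto simp: parallel_imp_def)

lemma series_imp_None [simp]: "series_imp z None = None"
  by (cases z) auto

lemma series_imp_commute: "series_imp z w = series_imp w z"
  by (cases z; cases w) (auto simp: add.commute)

lemma series_imp_assoc: "series_imp (series_imp z w) u = series_imp z (series_imp w u)"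
  by (cases z; cases w; cases u) (auto simp: add.assoc)

lemma series_imp_0 [simp]: "series_imp (Some 0) z = z"
  by (cases z) auto

lemma parallel_imp_commute: "parallel_imp z w = parallel_imp w z"
  by (simp add: parallel_imp_def series_imp_commute)

lemma parallel_imp_assoc: "parallel_imp (parallel_imp z w) u = parallel_imp z (parallel_imp w u)"
  by (simp add: parallel_imp_def series_imp_assoc)

lemma parallel_imp_left_commute: "parallel_imp z (parallel_imp w u) = parallel_imp w (parallel_imp z u)"
  by (metis parallel_imp_assoc parallel_imp_commute)

lemma parallel_imp_None [simp]: "parallel_imp None z = z" "parallel_imp z None = z"
  by (simp_all add: parallel_imp_def series_imp_commute[of _ "Some 0"])

lemma parallel_imp_0 [simp]: "parallel_imp (Some 0) z = Some 0" "parallel_imp z (Some 0) = Some 0"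
  by (simp_all add: parallel_imp_def)

text \<open>Signs matter: for \<open>w = - z\<close> with \<open>z\<close> nonzero the connection is
  open, while the quotient would be 0. If both vanish, division by zero happens to return the
  correct short circuit.\<close>

lemma parallel_imp_Some:
  "0 \<le> z \<Longrightarrow> 0 \<le> w \<Longrightarrow> parallel_imp (Some z) (Some w) = Some (z * w / (z + w))"
  by (auto simp: parallel_imp_def field_simps add_nonneg_eq_0_iff)

lemma parallel_imp_conductance:
  "0 \<le> g \<Longrightarrow> 0 \<le> w \<Longrightarrow> parallel_imp (reciprocal (Some g)) (Some w) = Some (w / (1 + g * w))"
  by (cases "w = 0"; cases "g = 0") (auto simp: parallel_imp_Some field_simps add_nonneg_eq_0_iff)

lemma reciprocal_parallel: "reciprocal (parallel_imp z w) = series_imp (reciprocal z) (reciprocal w)"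
  by (simp add: parallel_imp_def)

section \<open>Quotients of polynomials and the coefficient classes\<close>

definition ratio :: "ratfun \<Rightarrow> ratfun \<Rightarrow> impedance" where
  "ratio n d = (if d = 0 then None else Some (n / d))"

lemma reciprocal_ratio: "n \<noteq> 0 \<or> d \<noteq> 0 \<Longrightarrow> reciprocal (ratio n d) = ratio d n"
  by (auto simp: ratio_def)

lemma series_imp_ratio:
  "series_imp (ratio n d) (ratio n' d') = ratio (n * d' + n' * d) (d * d')"
  by (auto simp: ratio_def field_simps)

lemma ratio_cancel: "c \<noteq> 0 \<Longrightarrow> ratio (n * c) (d * c) = ratio n d"
  by (simp add: ratio_def)

definition lin :: "ratfun \<Rightarrow> real \<Rightarrow> real \<Rightarrow> ratfun" where
  "lin \<sigma> a b = const a * \<sigma> + const b"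

definition quad :: "ratfun \<Rightarrow> real \<Rightarrow> real \<Rightarrow> real \<Rightarrow> ratfun" where
  "quad \<sigma> a b c = const a * \<sigma>\<^sup>2 + const b * \<sigma> + const c"

lemma lin_eq_0_iff:
  assumes "\<sigma> > 0" "a \<ge> 0" "b \<ge> 0"
  shows "lin \<sigma> a b = 0 \<longleftrightarrow> a = 0 \<and> b = 0"
  using assms by (simp add: lin_def add_nonneg_eq_0_iff)

lemma quad_eq_0_iff:
  assumes "\<sigma> > 0" "a \<ge> 0" "b \<ge> 0" "c \<ge> 0"
  shows "quad \<sigma> a b c = 0 \<longleftrightarrow> a = 0 \<and> b = 0 \<and> c = 0"
  using assms by (auto simp add: quad_def add_nonneg_eq_0_iff)

lemma lin_inverse: "\<sigma> > 0 \<Longrightarrow> lin (1 / \<sigma>) a b * \<sigma> = lin \<sigma> b a"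
  by (simp add: lin_def field_simps)

lemma quad_inverse: "\<sigma> > 0 \<Longrightarrow> quad (1 / \<sigma>) a b c * \<sigma>\<^sup>2 = quad \<sigma> c b a"
  by (simp add: quad_def field_simps power2_eq_square)

text \<open>The strict inequality excludes the quotient 0/0, which \<open>ratio\<close> would read
  as an open circuit and for which \<open>reciprocal_ratio\<close> fails.\<close>

definition nonneg_coeffs :: "real \<Rightarrow> real \<Rightarrow> real \<Rightarrow> real \<Rightarrow> real \<Rightarrow> real \<Rightarrow> bool" where
  "nonneg_coeffs A B C D E F \<longleftrightarrow>
     0 \<le> A \<and> 0 \<le> B \<and> 0 \<le> C \<and> 0 \<le> D \<and> 0 \<le> E \<and> 0 \<le> F \<and> 0 < A + B + C + D + E + F"

text \<open>The last inequality says that the resultant of the two quadratics is nonpositive, the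
  opposite sign to the mixed case. A negative resultant of two genuine quadratics means that their
  roots are real and interlace, the classical pattern of RC impedances.\<close>

definition rc_coeffs :: "real \<Rightarrow> real \<Rightarrow> real \<Rightarrow> real \<Rightarrow> real \<Rightarrow> real \<Rightarrow> bool" where
  "rc_coeffs A B C D E F \<longleftrightarrow> nonneg_coeffs A B C D E F
     \<and> A * F \<le> C * D \<and> B * F \<le> C * E \<and> A * E \<le> B * D
     \<and> (A * F - C * D)\<^sup>2 \<le> (A * E - B * D) * (B * F - C * E)"

text \<open>
  In terms of \<open>Z(s) = (A s\<^sup>2 + B s + C) / (D s\<^sup>2 + E s + F)\<close>, the four alternatives say that the real
  part of \<open>Z(i\<omega>)\<close> or of \<open>1 / Z(i\<omega>)\<close> is smallest at \<open>\<omega> = 0\<close> or \<open>\<omega> = \<infinity>\<close> (the regular functions of Jiang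
  and Smith), and the sign of the resultant says that the two reactive elements have different kinds.
\<close>

definition regular_coeffs :: "real \<Rightarrow> real \<Rightarrow> real \<Rightarrow> real \<Rightarrow> real \<Rightarrow> real \<Rightarrow> bool" where
  "regular_coeffs A B C D E F \<longleftrightarrow> nonneg_coeffs A B C D E F
     \<and> (A * E - B * D) * (B * F - C * E) \<le> (A * F - C * D)\<^sup>2
     \<and> (C * D \<le> A * F \<and> F * (A * F - C * D) \<le> E * (B * F - C * E)
      \<or> C * D \<le> A * F \<and> A * (A * F - C * D) \<le> B * (A * E - B * D)
      \<or> A * F \<le> C * D \<and> E * (A * E - B * D) \<le> D * (A * F - C * D)
      \<or> A * F \<le> C * D \<and> B * (B * F - C * E) \<le> C * (A * F - C * D))"

definition resistive :: "impedance set" where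
  "resistive = insert None {Some (const R) | R. R \<ge> 0}"

definition RC1 :: "ratfun \<Rightarrow> impedance set" where
  "RC1 \<sigma> = {ratio (lin \<sigma> a b) (lin \<sigma> c d) | a b c d.
     0 \<le> a \<and> 0 \<le> b \<and> 0 \<le> c \<and> 0 \<le> d \<and> 0 < a + b + c + d \<and> a * d \<le> b * c}"

definition RC2 :: "ratfun \<Rightarrow> impedance set" where
  "RC2 \<sigma> = {ratio (quad \<sigma> A B C) (quad \<sigma> D E F) | A B C D E F. rc_coeffs A B C D E F}"

definition RLC :: "ratfun \<Rightarrow> impedance set" where
  "RLC \<sigma> = {ratio (quad \<sigma> A B C) (quad \<sigma> D E F) | A B C D E F. regular_coeffs A B C D E F}"

lemma RC1I:
  assumes "0 \<le> a" "0 \<le> b" "0 \<le> c" "0 \<le> d" "0 < a + b + c + d" "a * d \<le> b * c"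
  shows "ratio (lin \<sigma> a b) (lin \<sigma> c d) \<in> RC1 \<sigma>"
  unfolding RC1_def using assms by blast

lemma RC2I:
  "rc_coeffs A B C D E F \<Longrightarrow> ratio (quad \<sigma> A B C) (quad \<sigma> D E F) \<in> RC2 \<sigma>"
  unfolding RC2_def by blast

lemma RLCI:
  "regular_coeffs A B C D E F \<Longrightarrow> ratio (quad \<sigma> A B C) (quad \<sigma> D E F) \<in> RLC \<sigma>"
  unfolding RLC_def by blast

section \<open>Symmetries of the coefficient conditions\<close>

lemma nonneg_coeffs_swap: "nonneg_coeffs A B C D E F \<Longrightarrow> nonneg_coeffs D E F A B C"
  and nonneg_coeffs_rev: "nonneg_coeffs A B C D E F \<Longrightarrow> nonneg_coeffs C B A F E D"
  by (auto simp: nonneg_coeffs_def)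

text \<open>Isolates the minors, so that for each change of coefficients it suffices to say how
  \<open>p\<close>, \<open>q\<close>, \<open>r\<close> change.\<close>

lemma rc_coeffs_iff:
  assumes "A * E - B * D = p" "A * F - C * D = q" "B * F - C * E = r"
  shows "rc_coeffs A B C D E F \<longleftrightarrow>
    nonneg_coeffs A B C D E F \<and> q \<le> 0 \<and> r \<le> 0 \<and> p \<le> 0 \<and> q\<^sup>2 \<le> p * r"
  unfolding rc_coeffs_def by (simp flip: assms)

lemma regular_coeffs_iff:
  assumes "A * E - B * D = p" "A * F - C * D = q" "B * F - C * E = r"
  shows "regular_coeffs A B C D E F \<longleftrightarrow> nonneg_coeffs A B C D E F \<and> p * r \<le> q\<^sup>2
     \<and> (0 \<le> q \<and> F * q \<le> E * r \<or> 0 \<le> q \<and> A * q \<le> B * p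
      \<or> q \<le> 0 \<and> E * p \<le> D * q \<or> q \<le> 0 \<and> B * r \<le> C * q)"
  unfolding regular_coeffs_def by (simp flip: assms)

text \<open>Exchanging numerator and denominator negates all minors, and so does reversing the
  coefficients; only the two together preserve the signs. Hence the reciprocal of an RC impedance
  lies in the class at \<open>1 / \<sigma>\<close>.\<close>

lemma rc_coeffs_swap:
  assumes "rc_coeffs A B C D E F"
  shows "rc_coeffs F E D C B A"
proof -
  define p q r where pqr: "p = A * E - B * D" "q = A * F - C * D" "r = B * F - C * E"
  have "F * B - E * C = r" "F * A - D * C = q" "E * A - D * B = p"
    by (simp_all add: pqr mult.commute)
  note iff = rc_coeffs_iff[OF this] rc_coeffs_iff[OF pqr[symmetric]]
  show ?thesis
    using assms unfolding iff by (auto simp: nonneg_coeffs_def mult.commute)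
qed

text \<open>All minors change sign, which exchanges the first alternative with the fourth and the
  second with the third.\<close>

lemma regular_coeffs_swap:
  assumes "regular_coeffs A B C D E F"
  shows "regular_coeffs D E F A B C"
proof -
  define p q r where pqr: "p = A * E - B * D" "q = A * F - C * D" "r = B * F - C * E"
  have "D * B - E * A = - p" "D * C - F * A = - q" "E * C - F * B = - r"
    by (simp_all add: pqr mult.commute)
  note iff = regular_coeffs_iff[OF this] regular_coeffs_iff[OF pqr[symmetric]]
  show ?thesis
    using assms nonneg_coeffs_swap unfolding iff by simp blast
qed

text \<open>The minors become \<open>- r\<close>, \<open>- q\<close>, \<open>- p\<close>, which
  exchanges the first alternative with the third and the second with the fourth.\<close>

lemma regular_coeffs_rev:
  assumes "regular_coeffs A B C D E F"
  shows "regular_coeffs C B A F E D"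
proof -
  define p q r where pqr: "p = A * E - B * D" "q = A * F - C * D" "r = B * F - C * E"
  have "C * E - B * F = - r" "C * D - A * F = - q" "B * D - A * E = - p"
    by (simp_all add: pqr)
  note iff = regular_coeffs_iff[OF this] regular_coeffs_iff[OF pqr[symmetric]]
  show ?thesis
    using assms nonneg_coeffs_rev unfolding iff by (simp add: mult.commute[of r]) blast
qed

lemma lin_nz_cases:
  assumes "\<sigma> > 0" "0 \<le> a" "0 \<le> b" "0 \<le> c" "0 \<le> d" "0 < a + b + c + d"
  shows "lin \<sigma> a b \<noteq> 0 \<or> lin \<sigma> c d \<noteq> 0"
  using assms by (auto simp: lin_eq_0_iff)

lemma quad_nz_cases:
  assumes "\<sigma> > 0" "nonneg_coeffs A B C D E F"
  shows "quad \<sigma> A B C \<noteq> 0 \<or> quad \<sigma> D E F \<noteq> 0"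
  using assms by (auto simp: quad_eq_0_iff nonneg_coeffs_def)

lemma reciprocal_resistive:
  assumes "z \<in> resistive"
  shows "reciprocal z \<in> resistive"
proof -
  have "Some (1 / const R) \<in> resistive" if "R \<ge> 0" for R
    using that unfolding resistive_def by (auto intro!: exI[of _ "1 / R"])
  moreover have "Some 0 \<in> resistive" "None \<in> resistive"
    unfolding resistive_def by (auto intro!: exI[of _ 0])
  ultimately show ?thesis
    using assms by (subst (asm) resistive_def) auto
qed

lemma reciprocal_RC1:
  assumes "\<sigma> > 0" "z \<in> RC1 \<sigma>"
  shows "reciprocal z \<in> RC1 (1 / \<sigma>)"
proof -
  obtain a b c d where z: "z = ratio (lin \<sigma> a b) (lin \<sigma> c d)"
    and abcd: "0 \<le> a" "0 \<le> b" "0 \<le> c" "0 \<le> d" "0 < a + b + c + d" "a * d \<le> b * c"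
    using assms(2) unfolding RC1_def by blast
  have "reciprocal z = ratio (lin (1 / \<sigma>) d c * \<sigma>) (lin (1 / \<sigma>) b a * \<sigma>)"
    using assms(1) lin_nz_cases[OF assms(1) abcd(1-5)] by (simp add: z reciprocal_ratio lin_inverse)
  also have "\<dots> = ratio (lin (1 / \<sigma>) d c) (lin (1 / \<sigma>) b a)"
    using assms(1) by (simp add: ratio_cancel)
  finally have "reciprocal z = ratio (lin (1 / \<sigma>) d c) (lin (1 / \<sigma>) b a)" .
  moreover have "0 < d + c + b + a" "d * a \<le> c * b"
    using abcd by (simp_all add: ac_simps)
  ultimately show ?thesis
    using RC1I[of d c b a] abcd by simp
qed

lemma ratio_quad_inverse:
  "\<sigma> > 0 \<Longrightarrow> ratio (quad (1 / \<sigma>) A B C) (quad (1 / \<sigma>) D E F) = ratio (quad \<sigma> C B A) (quad \<sigma> F E D)"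
  using ratio_cancel[of "\<sigma>\<^sup>2" "quad (1 / \<sigma>) A B C" "quad (1 / \<sigma>) D E F"] by (simp add: quad_inverse)

lemma reciprocal_RC2:
  assumes "\<sigma> > 0" "z \<in> RC2 \<sigma>"
  shows "reciprocal z \<in> RC2 (1 / \<sigma>)"
proof -
  obtain A B C D E F where z: "z = ratio (quad \<sigma> A B C) (quad \<sigma> D E F)"
    and rc: "rc_coeffs A B C D E F"
    using assms(2) unfolding RC2_def by blast
  have "reciprocal z = ratio (quad (1 / \<sigma>) F E D) (quad (1 / \<sigma>) C B A)"
    using assms(1) quad_nz_cases[OF assms(1), of A B C D E F] rc
    by (simp add: z reciprocal_ratio ratio_quad_inverse rc_coeffs_def)
  then show ?thesis
    using rc_coeffs_swap[OF rc] unfolding RC2_def by blast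
qed

text \<open>Inversion exchanges the capacitor and the inductor, so the class with one of each is its
  own mirror image.\<close>

lemma RLC_inverse:
  assumes "\<sigma> > 0"
  shows "RLC (1 / \<sigma>) = RLC \<sigma>"
  using regular_coeffs_rev unfolding RLC_def ratio_quad_inverse[OF assms] by blast

lemma reciprocal_RLC:
  assumes "\<sigma> > 0" "z \<in> RLC \<sigma>"
  shows "reciprocal z \<in> RLC \<sigma>"
proof -
  obtain A B C D E F where z: "z = ratio (quad \<sigma> A B C) (quad \<sigma> D E F)"
    and reg: "regular_coeffs A B C D E F"
    using assms(2) unfolding RLC_def by blast
  have "reciprocal z = ratio (quad \<sigma> D E F) (quad \<sigma> A B C)"
    using quad_nz_cases[OF assms(1), of A B C D E F] reg
    by (simp add: z reciprocal_ratio regular_coeffs_def)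
  then show ?thesis
    using regular_coeffs_swap[OF reg] unfolding RLC_def by blast
qed

section \<open>Inclusions between the classes\<close>

lemma resistive_subset_RC1:
  assumes "\<sigma> > 0"
  shows "resistive \<subseteq> RC1 \<sigma>"
proof -
  have "ratio (lin \<sigma> 0 1) (lin \<sigma> 0 0) \<in> RC1 \<sigma>"
    by (rule RC1I) simp_all
  moreover have "ratio (lin \<sigma> 0 R) (lin \<sigma> 0 1) \<in> RC1 \<sigma>" if "R \<ge> 0" for R
    using that by (intro RC1I) simp_all
  ultimately show ?thesis
    by (auto simp: resistive_def ratio_def lin_def)
qed

lemma RC1_subset_RC2:
  assumes "\<sigma> > 0"
  shows "RC1 \<sigma> \<subseteq> RC2 \<sigma>"
proof
  fix z assume "z \<in> RC1 \<sigma>"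
  then obtain a b c d where z: "z = ratio (lin \<sigma> a b) (lin \<sigma> c d)"
    and abcd: "0 \<le> a" "0 \<le> b" "0 \<le> c" "0 \<le> d" "0 < a + b + c + d" "a * d \<le> b * c"
    unfolding RC1_def by blast
  have "z = ratio (quad \<sigma> 0 a b) (quad \<sigma> 0 c d)" "rc_coeffs 0 a b 0 c d"
    using abcd by (simp_all add: z lin_def quad_def rc_coeffs_def nonneg_coeffs_def)
  then show "z \<in> RC2 \<sigma>"
    unfolding RC2_def by blast
qed

lemma RC1_subset_RLC:
  assumes "\<sigma> > 0"
  shows "RC1 \<sigma> \<subseteq> RLC \<sigma>"
proof
  fix z assume "z \<in> RC1 \<sigma>"
  then obtain a b c d where z: "z = ratio (lin \<sigma> a b) (lin \<sigma> c d)"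
    and abcd: "0 \<le> a" "0 \<le> b" "0 \<le> c" "0 \<le> d" "0 < a + b + c + d" "a * d \<le> b * c"
    unfolding RC1_def by blast
  have "z = ratio (quad \<sigma> 0 a b) (quad \<sigma> 0 c d)" "regular_coeffs 0 a b 0 c d"
    using abcd by (simp_all add: z lin_def quad_def regular_coeffs_def nonneg_coeffs_def)
  then show "z \<in> RLC \<sigma>"
    unfolding RLC_def by blast
qed

lemma RL1_subset_RLC: "\<sigma> > 0 \<Longrightarrow> RC1 (1 / \<sigma>) \<subseteq> RLC \<sigma>"
  using RC1_subset_RLC[of "1 / \<sigma>"] by (simp add: RLC_inverse)

subsection \<open>Closure under connection with resistors\<close>

lemma series_imp_quad:
  assumes "\<sigma> > 0"
  shows "series_imp (Some (const R)) (ratio (quad \<sigma> A B C) (quad \<sigma> D E F))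
    = ratio (quad \<sigma> (A + R * D) (B + R * E) (C + R * F)) (quad \<sigma> D E F)"
  by (simp add: ratio_def quad_def field_simps)

lemma nonneg_coeffs_add:
  "nonneg_coeffs A B C D E F \<Longrightarrow> R \<ge> 0 \<Longrightarrow>
    nonneg_coeffs (A + R * D) (B + R * E) (C + R * F) D E F"
  unfolding nonneg_coeffs_def by (smt (verit) mult_nonneg_nonneg)

lemma rc_coeffs_add:
  assumes "rc_coeffs A B C D E F" "R \<ge> 0"
  shows "rc_coeffs (A + R * D) (B + R * E) (C + R * F) D E F"
proof -
  define p q r where pqr: "p = A * E - B * D" "q = A * F - C * D" "r = B * F - C * E"
  have "(A + R * D) * E - (B + R * E) * D = p" "(A + R * D) * F - (C + R * F) * D = q"
    "(B + R * E) * F - (C + R * F) * E = r"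
    by (simp_all add: pqr algebra_simps)
  note iff = rc_coeffs_iff[OF this] rc_coeffs_iff[OF pqr[symmetric]]
  show ?thesis
    using assms nonneg_coeffs_add unfolding iff by blast
qed

text \<open>With \<open>p\<close>, \<open>q\<close> the minors, a series resistance \<open>R\<close>
  adds \<open>R\<close> times \<open>D * q \<le> E * p\<close> to the alternative
  \<open>A * q \<le> B * p\<close>, so the former has to follow from the latter. For
  \<open>B > 0\<close> the hypothesis forces \<open>p\<close> to be nonnegative, hence
  \<open>B * D * q \<le> A * E * q \<le> B * E * p\<close>.\<close>

lemma regular_coeffs_add_aux:
  fixes A B C D E F :: real
  assumes "0 \<le> A" "0 \<le> B" "0 \<le> C" "0 \<le> D" "0 \<le> E"
    and "C * D \<le> A * F" "A * (A * F - C * D) \<le> B * (A * E - B * D)"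
  shows "D * (A * F - C * D) \<le> E * (A * E - B * D)"
proof (cases "B = 0")
  case True
  have "A * (A * F - C * D) = 0"
    using assms(7) mult_nonneg_nonneg[of A "A * F - C * D"] assms(1,6) True by (intro order_antisym) simp_all
  moreover have "A * F - C * D = 0" if "A = 0"
    using assms(6) that mult_nonneg_nonneg[OF assms(3,4)] by simp
  ultimately have "A * F - C * D = 0"
    by auto
  then show ?thesis
    using assms True by simp
next
  case False
  then have "B > 0" using assms by simp
  have "0 \<le> B * (A * E - B * D)"
    using assms(7) mult_nonneg_nonneg[of A "A * F - C * D"] assms by linarith
  then have p: "B * D \<le> A * E"
    using \<open>B > 0\<close> by (simp add: zero_le_mult_iff)
  have "B * (D * (A * F - C * D)) \<le> A * E * (A * F - C * D)"
    using mult_right_mono[OF p, of "A * F - C * D"] assms by (simp add: mult.assoc)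
  also have "\<dots> \<le> B * (E * (A * E - B * D))"
    using mult_left_mono[OF assms(7), of E] assms by (simp add: algebra_simps)
  finally show ?thesis
    using \<open>B > 0\<close> by (simp only: mult_le_cancel_left_pos)
qed

lemma regular_coeffs_add:
  assumes "regular_coeffs A B C D E F" "R \<ge> 0"
  shows "regular_coeffs (A + R * D) (B + R * E) (C + R * F) D E F"
proof -
  have nn: "0 \<le> A" "0 \<le> B" "0 \<le> C" "0 \<le> D" "0 \<le> E" "0 \<le> F"
    using assms unfolding regular_coeffs_def nonneg_coeffs_def by auto
  define p q r where pqr: "p = A * E - B * D" "q = A * F - C * D" "r = B * F - C * E"
  have "(A + R * D) * E - (B + R * E) * D = p" "(A + R * D) * F - (C + R * F) * D = q"
    "(B + R * E) * F - (C + R * F) * E = r"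
    by (simp_all add: pqr algebra_simps)
  note iff = regular_coeffs_iff[OF this] regular_coeffs_iff[OF pqr[symmetric]]
  \<comment> \<open>The labels 2 and 4 count the alternatives of \<open>regular_coeffs\<close>. The
    other two contain only denominator coefficients and minors, which do not change.\<close>
  have 2: "(A + R * D) * q \<le> (B + R * E) * p" if "0 \<le> q" "A * q \<le> B * p"
  proof -
    have "D * q \<le> E * p"
      using regular_coeffs_add_aux[of A B C D E F] nn that by (simp add: pqr)
    then have "R * (D * q) \<le> R * (E * p)"
      using assms(2) by (rule mult_left_mono)
    with that show ?thesis by (simp add: algebra_simps)
  qed
  have 4: "(B + R * E) * r \<le> (C + R * F) * q" if "q \<le> 0" "B * r \<le> C * q"
  proof -
    have "F * (- q) \<le> E * (- r)"
      using regular_coeffs_add_aux[of C B A F E D] nn that by (simp add: pqr algebra_simps)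
    then have "R * (F * (- q)) \<le> R * (E * (- r))"
      using assms(2) by (rule mult_left_mono)
    with that show ?thesis by (simp add: algebra_simps)
  qed
  show ?thesis
    using assms nonneg_coeffs_add 2 4 unfolding iff by blast
qed

lemma None_in_RC1: "\<sigma> > 0 \<Longrightarrow> None \<in> RC1 \<sigma>"
  using resistive_subset_RC1 by (auto simp: resistive_def)

lemma None_in_RC2: "\<sigma> > 0 \<Longrightarrow> None \<in> RC2 \<sigma>"
  using None_in_RC1 RC1_subset_RC2 by blast

lemma None_in_RLC: "\<sigma> > 0 \<Longrightarrow> None \<in> RLC \<sigma>"
  using None_in_RC1 RC1_subset_RLC by blast

lemma series_resistive_RC2:
  assumes "\<sigma> > 0" "r \<in> resistive" "z \<in> RC2 \<sigma>"
  shows "series_imp r z \<in> RC2 \<sigma>"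
proof (cases r)
  case None
  then show ?thesis
    by (simp add: assms(1) None_in_RC2)
next
  case (Some _)
  then obtain R where R: "r = Some (const R)" "R \<ge> 0"
    using assms(2) by (auto simp: resistive_def)
  obtain A B C D E F where z: "z = ratio (quad \<sigma> A B C) (quad \<sigma> D E F)"
    and coeffs: "rc_coeffs A B C D E F"
    using assms(3) unfolding RC2_def by blast
  have "series_imp r z = ratio (quad \<sigma> (A + R * D) (B + R * E) (C + R * F)) (quad \<sigma> D E F)"
    using series_imp_quad[OF assms(1)] by (simp add: R z)
  then show ?thesis
    using rc_coeffs_add[OF coeffs R(2)] unfolding RC2_def by blast
qed

lemma series_resistive_RLC:
  assumes "\<sigma> > 0" "r \<in> resistive" "z \<in> RLC \<sigma>"
  shows "series_imp r z \<in> RLC \<sigma>"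
proof (cases r)
  case None
  then show ?thesis
    by (simp add: assms(1) None_in_RLC)
next
  case (Some _)
  then obtain R where R: "r = Some (const R)" "R \<ge> 0"
    using assms(2) by (auto simp: resistive_def)
  obtain A B C D E F where z: "z = ratio (quad \<sigma> A B C) (quad \<sigma> D E F)"
    and coeffs: "regular_coeffs A B C D E F"
    using assms(3) unfolding RLC_def by blast
  have "series_imp r z = ratio (quad \<sigma> (A + R * D) (B + R * E) (C + R * F)) (quad \<sigma> D E F)"
    using series_imp_quad[OF assms(1)] by (simp add: R z)
  then show ?thesis
    using regular_coeffs_add[OF coeffs R(2)] unfolding RLC_def by blast
qed

lemma series_resistive_RC1:
  assumes "\<sigma> > 0" "r \<in> resistive" "z \<in> RC1 \<sigma>"
  shows "series_imp r z \<in> RC1 \<sigma>"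
proof (cases r)
  case None
  then show ?thesis
    by (simp add: assms(1) None_in_RC1)
next
  case (Some _)
  then obtain R where R: "r = Some (const R)" "R \<ge> 0"
    using assms(2) by (auto simp: resistive_def)
  obtain a b c d where z: "z = ratio (lin \<sigma> a b) (lin \<sigma> c d)"
    and abcd: "0 \<le> a" "0 \<le> b" "0 \<le> c" "0 \<le> d" "0 < a + b + c + d" "a * d \<le> b * c"
    using assms(3) unfolding RC1_def by blast
  have "series_imp r z = ratio (lin \<sigma> (a + R * c) (b + R * d)) (lin \<sigma> c d)"
    by (simp add: R z ratio_def lin_def field_simps)
  moreover have "0 \<le> a + R * c" "0 \<le> b + R * d" "0 < (a + R * c) + (b + R * d) + c + d"
    "(a + R * c) * d \<le> (b + R * d) * c"
  proof -
    have "0 \<le> R * c" "0 \<le> R * d"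
      using abcd R by simp_all
    then show "0 \<le> a + R * c" "0 \<le> b + R * d" "0 < (a + R * c) + (b + R * d) + c + d"
      using abcd by linarith+
    show "(a + R * c) * d \<le> (b + R * d) * c"
      using abcd by (simp add: algebra_simps)
  qed
  ultimately show ?thesis
    using abcd unfolding RC1_def by blast
qed

lemma parallel_via_reciprocal:
  assumes "series_imp (reciprocal r) (reciprocal z) \<in> S" "\<And>y. y \<in> S \<Longrightarrow> reciprocal y \<in> T"
  shows "parallel_imp r z \<in> T"
  using assms by (simp add: parallel_imp_def)

lemma parallel_resistive_RC1:
  assumes "\<sigma> > 0" "r \<in> resistive" "z \<in> RC1 \<sigma>"
  shows "parallel_imp r z \<in> RC1 \<sigma>"
proof (rule parallel_via_reciprocal)
  show "series_imp (reciprocal r) (reciprocal z) \<in> RC1 (1 / \<sigma>)"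
    using assms by (intro series_resistive_RC1 reciprocal_resistive reciprocal_RC1) auto
  show "reciprocal y \<in> RC1 \<sigma>" if "y \<in> RC1 (1 / \<sigma>)" for y
    using reciprocal_RC1[OF _ that] assms by simp
qed

lemma parallel_resistive_RC2:
  assumes "\<sigma> > 0" "r \<in> resistive" "z \<in> RC2 \<sigma>"
  shows "parallel_imp r z \<in> RC2 \<sigma>"
proof (rule parallel_via_reciprocal)
  show "series_imp (reciprocal r) (reciprocal z) \<in> RC2 (1 / \<sigma>)"
    using assms by (intro series_resistive_RC2 reciprocal_resistive reciprocal_RC2) auto
  show "reciprocal y \<in> RC2 \<sigma>" if "y \<in> RC2 (1 / \<sigma>)" for y
    using reciprocal_RC2[OF _ that] assms by simp
qed

lemma parallel_resistive_RLC:
  assumes "\<sigma> > 0" "r \<in> resistive" "z \<in> RLC \<sigma>"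
  shows "parallel_imp r z \<in> RLC \<sigma>"
  using assms reciprocal_RLC
  by (intro parallel_via_reciprocal[where S = "RLC \<sigma>"] series_resistive_RLC reciprocal_resistive) auto


subsection \<open>Connections of networks with one storage element\<close>

text \<open>Division with remainder: \<open>R = a / c\<close> is the value at infinity, and the
  remainder \<open>(b * c - a * d) / c\<close> is nonnegative by the class inequality. If it
  vanishes, or if \<open>c = 0\<close>, no capacitor is left.\<close>

lemma RC1_cases:
  assumes "\<sigma> > 0" "z \<in> RC1 \<sigma>"
  obtains "z \<in> resistive"
  | R G C where "R \<ge> 0" "G \<ge> 0" "C > 0" "z = Some (const R + 1 / (const C * \<sigma> + const G))"
proof -
  obtain a b c d where z: "z = ratio (lin \<sigma> a b) (lin \<sigma> c d)"
    and abcd: "0 \<le> a" "0 \<le> b" "0 \<le> c" "0 \<le> d" "0 < a + b + c + d" "a * d \<le> b * c"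
    using assms(2) unfolding RC1_def by blast
  show thesis
  proof (cases "c = 0")
    case True
    with abcd have "a = 0 \<or> d = 0"
      using mult_nonneg_nonneg[of a d] by (auto simp del: mult_nonneg_nonneg)
    then have "z = Some (const (b / d)) \<or> z = None"
      using True by (auto simp: z ratio_def lin_def)
    then show thesis
      using that(1) abcd by (auto simp: resistive_def simp del: const_divide)
  next
    case False
    with abcd have c: "c > 0" by simp
    have den: "const c * \<sigma> + const d > 0"
      using c abcd assms(1) by (simp add: add_pos_nonneg)
    define n where "n = (b * c - a * d) / c"
    have n: "n \<ge> 0"
      using c abcd by (simp add: n_def)
    have b: "b = n + a * d / c"
      using c by (simp add: n_def field_simps)
    have z': "z = Some (const (a / c) + const n / (const c * \<sigma> + const d))"
      using den c by (simp add: z ratio_def lin_def b field_simps)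
    show thesis
    proof (cases "n = 0")
      case True
      then have "z = Some (const (a / c))"
        using z' by simp
      moreover have "a / c \<ge> 0"
        using abcd by simp
      ultimately show thesis
        using that(1) unfolding resistive_def by blast
    next
      case False
      have "1 / (const (c / n) * \<sigma> + const (d / n)) = const n / (const c * \<sigma> + const d)"
        using False den by (simp add: field_simps)
      then show thesis
        using that(2)[of "a / c" "d / n" "c / n"] z' n False c abcd by simp
    qed
  qed
qed

text \<open>The minors of the sum are combinations of the determinants \<open>u\<close>,
  \<open>v\<close> of the summands with nonnegative weights, so their signs are clear. The resultant
  condition is Lagrange's identity: the difference of its two sides is \<open>u * v\<close> times a
  square.\<close>

lemma rc_coeffs_sum:
  assumes "0 \<le> a" "0 \<le> b" "0 \<le> c" "0 \<le> d" "0 \<le> a'" "0 \<le> b'" "0 \<le> c'" "0 \<le> d'"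
    and "0 < c + d" "0 < c' + d'" "a * d \<le> b * c" "a' * d' \<le> b' * c'"
  shows "rc_coeffs (a * c' + a' * c) (a * d' + b * c' + a' * d + b' * c) (b * d' + b' * d)
    (c * c') (c * d' + d * c') (d * d')"
proof -
  define u v where "u = a * d - b * c" and "v = a' * d' - b' * c'"
  have uv: "u \<le> 0" "v \<le> 0"
    using assms by (simp_all add: u_def v_def)
  have "(a * c' + a' * c) * (c * d' + d * c') - (a * d' + b * c' + a' * d + b' * c) * (c * c')
      = c'\<^sup>2 * u + c\<^sup>2 * v"
    and "(a * c' + a' * c) * (d * d') - (b * d' + b' * d) * (c * c') = c' * d' * u + c * d * v"
    and "(a * d' + b * c' + a' * d + b' * c) * (d * d') - (b * d' + b' * d) * (c * d' + d * c')
      = d'\<^sup>2 * u + d\<^sup>2 * v"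
    by (simp_all add: u_def v_def algebra_simps power2_eq_square)
  note iff = rc_coeffs_iff[OF this]
  have "0 \<le> u * v * (c' * d - c * d')\<^sup>2"
    using uv by (simp add: mult_nonpos_nonpos)
  also have "\<dots> = (c'\<^sup>2 * u + c\<^sup>2 * v) * (d'\<^sup>2 * u + d\<^sup>2 * v) - (c' * d' * u + c * d * v)\<^sup>2"
    by (simp add: algebra_simps power2_eq_square)
  finally have res: "(c' * d' * u + c * d * v)\<^sup>2 \<le> (c'\<^sup>2 * u + c\<^sup>2 * v) * (d'\<^sup>2 * u + d\<^sup>2 * v)"
    by simp
  have "0 < (c + d) * (c' + d')"
    using assms by simp
  then have "0 < c * c' + (c * d' + d * c') + d * d'"
    by (simp add: algebra_simps)
  moreover have "0 \<le> a * c'" "0 \<le> a' * c" "0 \<le> a * d'" "0 \<le> b * c'" "0 \<le> a' * d" "0 \<le> b' * c"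
    "0 \<le> b * d'" "0 \<le> b' * d" "0 \<le> c * c'" "0 \<le> c * d'" "0 \<le> d * c'" "0 \<le> d * d'"
    using assms by simp_all
  ultimately have "nonneg_coeffs (a * c' + a' * c) (a * d' + b * c' + a' * d + b' * c)
      (b * d' + b' * d) (c * c') (c * d' + d * c') (d * d')"
    unfolding nonneg_coeffs_def by linarith
  moreover have "c'\<^sup>2 * u \<le> 0" "c\<^sup>2 * v \<le> 0" "c' * d' * u \<le> 0" "c * d * v \<le> 0"
    "d'\<^sup>2 * u \<le> 0" "d\<^sup>2 * v \<le> 0"
    using uv assms by (simp_all add: mult_nonneg_nonpos)
  ultimately show ?thesis
    unfolding iff using res by linarith
qed

lemma series_RC1_RC1:
  assumes "\<sigma> > 0" "z \<in> RC1 \<sigma>" "w \<in> RC1 \<sigma>"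
  shows "series_imp z w \<in> RC2 \<sigma>"
proof (cases "z = None \<or> w = None")
  case True
  then show ?thesis
    using None_in_RC2[OF assms(1)] by auto
next
  case False
  obtain a b c d where z: "z = ratio (lin \<sigma> a b) (lin \<sigma> c d)"
    and abcd: "0 \<le> a" "0 \<le> b" "0 \<le> c" "0 \<le> d" "a * d \<le> b * c"
    using assms(2) unfolding RC1_def by blast
  obtain a' b' c' d' where w: "w = ratio (lin \<sigma> a' b') (lin \<sigma> c' d')"
    and abcd': "0 \<le> a'" "0 \<le> b'" "0 \<le> c'" "0 \<le> d'" "a' * d' \<le> b' * c'"
    using assms(3) unfolding RC1_def by blast
  have "\<not> (c = 0 \<and> d = 0)" "\<not> (c' = 0 \<and> d' = 0)"
    using False by (auto simp: z w ratio_def lin_def)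
  then have "0 < c + d" "0 < c' + d'"
    using abcd abcd' by linarith+
  note rc = rc_coeffs_sum[OF abcd(1-4) abcd'(1-4) this abcd(5) abcd'(5)]
  have "series_imp z w = ratio
      (quad \<sigma> (a * c' + a' * c) (a * d' + b * c' + a' * d + b' * c) (b * d' + b' * d))
      (quad \<sigma> (c * c') (c * d' + d * c') (d * d'))"
    unfolding z w series_imp_ratio
    by (rule arg_cong2[of _ _ _ _ ratio]) (simp_all add: lin_def quad_def algebra_simps power2_eq_square)
  with RC2I[OF rc] show ?thesis
    by simp
qed

text \<open>These are the coefficients of
  \<open>1 / (c * \<sigma> + g) + \<sigma> / (h * \<sigma> + k)\<close>: a capacitor shunted by
  \<open>g\<close> in series with an inductor \<open>1 / k\<close> shunted by \<open>h\<close>. The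
  sign of \<open>g - h\<close> decides which pair of alternatives is available.\<close>

lemma regular_coeffs_series:
  assumes "0 < c" "0 < k" "0 \<le> g" "0 \<le> h"
  shows "regular_coeffs c (g + h) k (c * h) (c * k + g * h) (g * k)"
proof -
  have "c * (c * k + g * h) - (g + h) * (c * h) = c * (c * k - h\<^sup>2)"
    and "c * (g * k) - k * (c * h) = c * k * (g - h)"
    and "(g + h) * (g * k) - k * (c * k + g * h) = k * (g\<^sup>2 - c * k)"
    by (simp_all add: algebra_simps power2_eq_square)
  note iff = regular_coeffs_iff[OF this]
  have nn: "nonneg_coeffs c (g + h) k (c * h) (c * k + g * h) (g * k)"
    using assms unfolding nonneg_coeffs_def by (simp add: add_pos_nonneg)
  have "(c * k * (g - h))\<^sup>2 - c * (c * k - h\<^sup>2) * (k * (g\<^sup>2 - c * k)) = c * k * (c * k - g * h)\<^sup>2"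
    by (simp add: algebra_simps power2_eq_square)
  moreover have "0 \<le> c * k * (c * k - g * h)\<^sup>2"
    using assms by simp
  ultimately have res: "c * (c * k - h\<^sup>2) * (k * (g\<^sup>2 - c * k)) \<le> (c * k * (g - h))\<^sup>2"
    by linarith
  \<comment> \<open>Right side minus left side of each of the four alternatives, in factored
    form.\<close>
  have l1: "(c * k + g * h) * (k * (g\<^sup>2 - c * k)) - g * k * (c * k * (g - h))
      = k * (g ^ 3 * h - (c * k)\<^sup>2)"
    and l2: "(g + h) * (c * (c * k - h\<^sup>2)) - c * (c * k * (g - h))
      = c * h * (2 * (c * k) - h * (g + h))"
    and l3: "c * h * (c * k * (g - h)) - (c * k + g * h) * (c * (c * k - h\<^sup>2))
      = c * (h ^ 3 * g - (c * k)\<^sup>2)"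
    and l4: "k * (c * k * (g - h)) - (g + h) * (k * (g\<^sup>2 - c * k))
      = k * g * (2 * (c * k) - g * (g + h))"
    by (simp_all add: algebra_simps power2_eq_square power3_eq_cube)
  \<comment> \<open>Here \<open>y\<close> is the larger and \<open>x\<close> the smaller of
    \<open>g\<close> and \<open>h\<close>. If the second inequality fails, then
    \<open>c * k < x * (x + y) / 2 \<le> x * y\<close>, and squaring gives the first.\<close>
  have key: "y ^ 3 * x \<ge> (c * k)\<^sup>2 \<or> 2 * (c * k) \<ge> x * (y + x)" if "0 \<le> x" "x \<le> y" for x y :: real
  proof (rule disjCI)
    assume "\<not> 2 * (c * k) \<ge> x * (y + x)"
    then have "2 * (c * k) \<le> x * (y + x)" by simp
    also have "\<dots> \<le> x * (y + y)"
      using that by (intro mult_left_mono) auto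
    finally have "c * k \<le> x * y" by simp
    then have "(c * k)\<^sup>2 \<le> (x * y)\<^sup>2"
      using assms by (intro power_mono) auto
    also have "\<dots> = (x * y\<^sup>2) * x"
      by (simp add: power2_eq_square)
    also have "\<dots> \<le> (x * y\<^sup>2) * y"
      using that by (intro mult_left_mono) auto
    also have "\<dots> = y ^ 3 * x"
      by (simp add: power2_eq_square power3_eq_cube)
    finally show "(c * k)\<^sup>2 \<le> y ^ 3 * x" .
  qed
  show ?thesis
  proof (cases "h \<le> g")
    case True
    then have q: "0 \<le> c * k * (g - h)"
      using assms by simp
    from key[OF assms(4) True]
    have "0 \<le> k * (g ^ 3 * h - (c * k)\<^sup>2) \<or> 0 \<le> c * h * (2 * (c * k) - h * (g + h))"
      using assms by (auto intro!: mult_nonneg_nonneg)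
    then show ?thesis
      unfolding iff l1[symmetric] l2[symmetric] using nn res q by linarith
  next
    case False
    then have q: "c * k * (g - h) \<le> 0"
      using assms by (simp add: mult_nonneg_nonpos)
    from key[OF assms(3), of h] False
    have "0 \<le> c * (h ^ 3 * g - (c * k)\<^sup>2) \<or> 0 \<le> k * g * (2 * (c * k) - g * (g + h))"
      using assms by (auto intro!: mult_nonneg_nonneg simp: add.commute)
    then show ?thesis
      unfolding iff l3[symmetric] l4[symmetric] using nn res q by linarith
  qed
qed

text \<open>Both series resistances are split off first and restored by closure under resistors, so
  that only two shunted reactive elements in series have to be computed.\<close>

lemma series_RC1_RL1:
  assumes "\<sigma> > 0" "z \<in> RC1 \<sigma>" "w \<in> RC1 (1 / \<sigma>)"
  shows "series_imp z w \<in> RLC \<sigma>"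
  using assms(1,2)
proof (cases rule: RC1_cases)
  case 1
  then show ?thesis
    using series_resistive_RLC RL1_subset_RLC assms by blast
next
  case (2 R g c)
  note z = this
  from assms(1) have "1 / \<sigma> > 0" by simp
  from this assms(3) show ?thesis
  proof (cases rule: RC1_cases)
    case 1
    then show ?thesis
      using series_resistive_RLC RC1_subset_RLC assms series_imp_commute[of z] by force
  next
    case (2 R' h k)
    let ?x = "1 / (const c * \<sigma> + const g)" and ?y = "1 / (const k * (1 / \<sigma>) + const h)"
    have pos: "0 < const c * \<sigma> + const g" "0 < const k + const h * \<sigma>"
      using z 2 assms(1) by (simp_all add: add_pos_nonneg)
    have y: "?y = \<sigma> / (const k + const h * \<sigma>)"
      using assms(1) pos by (simp add: field_simps)
    have "quad \<sigma> (c * h) (c * k + g * h) (g * k) = (const c * \<sigma> + const g) * (const k + const h * \<sigma>)"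
      by (simp add: quad_def algebra_simps power2_eq_square)
    moreover have "quad \<sigma> c (g + h) k = (const k + const h * \<sigma>) + \<sigma> * (const c * \<sigma> + const g)"
      by (simp add: quad_def algebra_simps power2_eq_square)
    ultimately have "Some (?x + ?y) = ratio (quad \<sigma> c (g + h) k) (quad \<sigma> (c * h) (c * k + g * h) (g * k))"
      unfolding y ratio_def using pos by (simp add: add_frac_eq)
    then have "Some (?x + ?y) \<in> RLC \<sigma>"
      using RLCI[OF regular_coeffs_series[of c k g h]] z 2 by simp
    moreover have "Some (const R) \<in> resistive" "Some (const R') \<in> resistive"
      using z 2 by (auto simp: resistive_def)
    ultimately have "series_imp (Some (const R)) (series_imp (Some (const R')) (Some (?x + ?y))) \<in> RLC \<sigma>"
      using series_resistive_RLC assms(1) by blast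
    moreover have "series_imp z w = series_imp (Some (const R)) (series_imp (Some (const R')) (Some (?x + ?y)))"
      by (simp add: z(4) 2(4))
    ultimately show ?thesis
      by simp
  qed
qed

lemma parallel_RC1_RC1:
  assumes "\<sigma> > 0" "z \<in> RC1 \<sigma>" "w \<in> RC1 \<sigma>"
  shows "parallel_imp z w \<in> RC2 \<sigma>"
proof (rule parallel_via_reciprocal)
  show "series_imp (reciprocal z) (reciprocal w) \<in> RC2 (1 / \<sigma>)"
    using assms by (intro series_RC1_RC1 reciprocal_RC1) auto
  show "reciprocal y \<in> RC2 \<sigma>" if "y \<in> RC2 (1 / \<sigma>)" for y
    using reciprocal_RC2[OF _ that] assms by simp
qed

lemma parallel_RC1_RL1:
  assumes "\<sigma> > 0" "z \<in> RC1 \<sigma>" "w \<in> RC1 (1 / \<sigma>)"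
  shows "parallel_imp z w \<in> RLC \<sigma>"
proof (rule parallel_via_reciprocal)
  show "series_imp (reciprocal z) (reciprocal w) \<in> RLC (1 / \<sigma>)"
    using assms by (intro series_RC1_RL1 reciprocal_RC1) auto
  show "reciprocal y \<in> RLC \<sigma>" if "y \<in> RLC (1 / \<sigma>)" for y
    using reciprocal_RLC[OF assms(1)] that RLC_inverse[OF assms(1)] by simp
qed


subsection \<open>Ladders\<close>

text \<open>Change of impedance level. It compensates for the factor that appears when a parallel
  resistor is moved past a series resistor.\<close>

definition scale :: "real \<Rightarrow> impedance \<Rightarrow> impedance" where
  "scale k = map_option (\<lambda>z. const k * z)"

lemma scale_simps [simp]: "scale k None = None" "scale k (Some z) = Some (const k * z)"
  by (simp_all add: scale_def)

lemma scale_series: "scale k (series_imp z w) = series_imp (scale k z) (scale k w)"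
  by (cases z; cases w) (auto simp: algebra_simps)

lemma scale_reciprocal: "k > 0 \<Longrightarrow> reciprocal (scale k z) = scale (1 / k) (reciprocal z)"
  by (cases z) auto

lemma scale_parallel:
  assumes "k > 0"
  shows "scale k (parallel_imp z w) = parallel_imp (scale k z) (scale k w)"
proof -
  have "scale k (reciprocal u) = reciprocal (scale (1 / k) u)" for u
    using assms scale_reciprocal[of "1 / k" u] by simp
  then have "scale k (parallel_imp z w) = reciprocal (scale (1 / k) (series_imp (reciprocal z) (reciprocal w)))"
    unfolding parallel_imp_def by blast
  then show ?thesis
    unfolding parallel_imp_def scale_series scale_reciprocal[OF assms] .
qed

lemma scale_ratio: "scale k (ratio n d) = ratio (const k * n) d"
  by (auto simp: ratio_def)

lemma scale_RC1:
  assumes "k > 0" "z \<in> RC1 \<sigma>"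
  shows "scale k z \<in> RC1 \<sigma>"
proof -
  obtain a b c d where z: "z = ratio (lin \<sigma> a b) (lin \<sigma> c d)"
    and abcd: "0 \<le> a" "0 \<le> b" "0 \<le> c" "0 \<le> d" "0 < a + b + c + d" "a * d \<le> b * c"
    using assms(2) unfolding RC1_def by blast
  have "scale k z = ratio (lin \<sigma> (k * a) (k * b)) (lin \<sigma> c d)"
    by (simp add: z scale_ratio lin_def algebra_simps)
  moreover have "0 < k * a + k * b + c + d"
  proof (cases "a + b = 0")
    case True
    then show ?thesis
      using abcd by (simp flip: distrib_left)
  next
    case False
    then have "0 < k * (a + b)"
      using abcd assms by simp
    then show ?thesis
      using abcd unfolding distrib_left by linarith
  qed
  moreover have "k * a * d \<le> k * b * c"
    using abcd assms by (simp add: mult.assoc)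
  ultimately show ?thesis
    using abcd assms by (simp add: RC1I)
qed

lemma nonneg_coeffs_scale:
  assumes "k > 0" "nonneg_coeffs A B C D E F"
  shows "nonneg_coeffs (k * A) (k * B) (k * C) D E F"
proof (cases "A + B + C = 0")
  case True
  then show ?thesis
    using assms by (simp add: nonneg_coeffs_def flip: distrib_left)
next
  case False
  then have "0 < k * (A + B + C)"
    using assms by (simp add: nonneg_coeffs_def)
  moreover have "0 \<le> k * A" "0 \<le> k * B" "0 \<le> k * C"
    using assms by (simp_all add: nonneg_coeffs_def)
  ultimately show ?thesis
    using assms unfolding nonneg_coeffs_def distrib_left by linarith
qed

lemma rc_coeffs_scale:
  assumes "k > 0" "rc_coeffs A B C D E F"
  shows "rc_coeffs (k * A) (k * B) (k * C) D E F"
proof -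
  define p q r where pqr: "p = A * E - B * D" "q = A * F - C * D" "r = B * F - C * E"
  have "k * A * E - k * B * D = k * p" "k * A * F - k * C * D = k * q" "k * B * F - k * C * E = k * r"
    by (simp_all add: pqr algebra_simps)
  note iff = rc_coeffs_iff[OF this] rc_coeffs_iff[OF pqr[symmetric]]
  have "(k * q)\<^sup>2 \<le> k * p * (k * r) \<longleftrightarrow> q\<^sup>2 \<le> p * r"
    using assms(1) mult_le_cancel_left_pos[of "k * k" "q\<^sup>2" "p * r"]
    by (simp add: power2_eq_square ac_simps)
  then show ?thesis
    using assms nonneg_coeffs_scale[OF assms(1), of A B C D E F] unfolding iff
    by (simp add: mult_le_0_iff)
qed

lemma regular_coeffs_scale:
  assumes "k > 0" "regular_coeffs A B C D E F"
  shows "regular_coeffs (k * A) (k * B) (k * C) D E F"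
proof -
  define p q r where pqr: "p = A * E - B * D" "q = A * F - C * D" "r = B * F - C * E"
  have "k * A * E - k * B * D = k * p" "k * A * F - k * C * D = k * q" "k * B * F - k * C * E = k * r"
    by (simp_all add: pqr algebra_simps)
  note iff = regular_coeffs_iff[OF this] regular_coeffs_iff[OF pqr[symmetric]]
  have "k * p * (k * r) \<le> (k * q)\<^sup>2 \<longleftrightarrow> p * r \<le> q\<^sup>2"
    using assms(1) mult_le_cancel_left_pos[of "k * k" "p * r" "q\<^sup>2"]
    by (simp add: power2_eq_square ac_simps)
  moreover have "x * (k * y) \<le> z * (k * w) \<longleftrightarrow> x * y \<le> z * w"
    "k * x * (k * y) \<le> k * z * (k * w) \<longleftrightarrow> x * y \<le> z * w" for x y z w
    using assms(1) mult_le_cancel_left_pos[of k "x * y" "z * w"]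
      mult_le_cancel_left_pos[of "k * k" "x * y" "z * w"] by (simp_all add: ac_simps)
  moreover have "0 \<le> k * q \<longleftrightarrow> 0 \<le> q" "k * q \<le> 0 \<longleftrightarrow> q \<le> 0"
    using assms(1) by (simp_all add: zero_le_mult_iff mult_le_0_iff)
  ultimately show ?thesis
    using assms nonneg_coeffs_scale[OF assms(1), of A B C D E F] unfolding iff
    by simp
qed

lemma scale_quad_ratio:
  "scale k (ratio (quad \<sigma> A B C) (quad \<sigma> D E F)) = ratio (quad \<sigma> (k * A) (k * B) (k * C)) (quad \<sigma> D E F)"
  by (simp add: scale_ratio quad_def algebra_simps)

lemma scale_RC2: "k > 0 \<Longrightarrow> z \<in> RC2 \<sigma> \<Longrightarrow> scale k z \<in> RC2 \<sigma>"
  using RC2I[OF rc_coeffs_scale] by (force simp: RC2_def scale_quad_ratio)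

lemma scale_RLC: "k > 0 \<Longrightarrow> z \<in> RLC \<sigma> \<Longrightarrow> scale k z \<in> RLC \<sigma>"
  using RLCI[OF regular_coeffs_scale] by (force simp: RLC_def scale_quad_ratio)

lemma RC1_nonneg: "\<sigma> > 0 \<Longrightarrow> Some z \<in> RC1 \<sigma> \<Longrightarrow> 0 \<le> z"
  by (auto simp: RC1_def ratio_def lin_def split: if_splits)

lemma RC2_nonneg: "\<sigma> > 0 \<Longrightarrow> Some z \<in> RC2 \<sigma> \<Longrightarrow> 0 \<le> z"
  by (auto simp: RC2_def ratio_def quad_def rc_coeffs_def nonneg_coeffs_def split: if_splits)

lemma RLC_nonneg: "\<sigma> > 0 \<Longrightarrow> Some z \<in> RLC \<sigma> \<Longrightarrow> 0 \<le> z"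
  by (auto simp: RLC_def ratio_def quad_def regular_coeffs_def nonneg_coeffs_def split: if_splits)

text \<open>
  A resistor in parallel with \<open>R \<oplus> W\<close> is a Moebius transformation of \<open>W\<close> with nonnegative
  coefficients and positive determinant, so it can be rewritten with the series resistor outermost
  at the price of rescaling \<open>W\<close>.
\<close>

lemma parallel_series_resistor:
  fixes G R :: real
  assumes "G > 0" "R \<ge> 0" "\<And>w. W = Some w \<Longrightarrow> 0 \<le> w"
  defines "t \<equiv> 1 + G * R"
  shows "parallel_imp (reciprocal (Some (const G))) (series_imp (Some (const R)) W)
    = series_imp (Some (const (R / t)))
        (parallel_imp (reciprocal (Some (const (G * t)))) (scale (1 / t\<^sup>2) W))"
proof -
  have t: "t > 0"
    using assms by (simp add: add_pos_nonneg)
  define g r \<tau> where "g = const G" and "r = const R" and "\<tau> = const t"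
  have pos: "g > 0" "r \<ge> 0" "\<tau> > 0"
    using assms(1,2) t by (simp_all add: g_def r_def \<tau>_def)
  have \<tau>: "\<tau> = 1 + g * r"
    by (simp add: \<tau>_def g_def r_def t_def)
  have t2: "const (t\<^sup>2) = \<tau>\<^sup>2"
    by (simp add: \<tau>_def power2_eq_square)
  show ?thesis
  proof (cases W)
    case None
    \<comment> \<open>The three constants are forced: a Moebius map is determined by its value at
      \<open>W = 0\<close>, which gives \<open>R / t\<close>, its derivative there, which gives
      \<open>1 / t\<^sup>2\<close>, and its value at infinity. The last is checked here.\<close>
    have "1 / g = r / \<tau> + 1 / (g * \<tau>)"
      using pos by (simp add: field_simps) (simp add: \<tau>)
    then show ?thesis
      using None pos assms(1) t by (simp add: g_def r_def \<tau>_def)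
  next
    case (Some w)
    with assms have w: "w \<ge> 0" by simp
    have pos': "1 + g * (r + w) > 0" "1 + g * \<tau> * (w / \<tau>\<^sup>2) > 0"
      using pos w by (simp_all add: add_pos_nonneg)
    have eq: "1 + g * \<tau> * (w / \<tau>\<^sup>2) = (\<tau> + g * w) / \<tau>"
      using pos by (simp add: field_simps power2_eq_square)
    have pos'': "\<tau> + g * w > 0"
      using pos w by (simp add: add_pos_nonneg)
    have eq': "1 + g * (r + w) = \<tau> + g * w"
      by (simp add: \<tau> algebra_simps)
    have "(r + w) / (\<tau> + g * w) = r / \<tau> + w / \<tau>\<^sup>2 / ((\<tau> + g * w) / \<tau>)"
    proof -
      have "r / \<tau> + w / \<tau>\<^sup>2 / (d / \<tau>) = (r * d + w) / (\<tau> * d)" if "d > 0" for d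
        using pos that by (simp add: add_frac_eq power2_eq_square) (simp add: field_simps)
      from this[OF pos''] have "r / \<tau> + w / \<tau>\<^sup>2 / ((\<tau> + g * w) / \<tau>)
          = (r * (\<tau> + g * w) + w) / (\<tau> * (\<tau> + g * w))" .
      also have "r * (\<tau> + g * w) + w = \<tau> * (r + w)"
        by (simp add: \<tau> algebra_simps)
      also have "\<tau> * (r + w) / (\<tau> * (\<tau> + g * w)) = (r + w) / (\<tau> + g * w)"
        using pos by simp
      finally show ?thesis ..
    qed
    then have main: "(r + w) / (1 + g * (r + w)) = r / \<tau> + w / \<tau>\<^sup>2 / (1 + g * \<tau> * (w / \<tau>\<^sup>2))"
      unfolding eq eq' .
    have "const (R / t) = r / \<tau>" "const (G * t) = g * \<tau>" "const (1 / t\<^sup>2) * w = w / \<tau>\<^sup>2"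
      by (simp_all add: g_def r_def \<tau>_def t2[unfolded \<tau>_def])
    then show ?thesis
      using main pos w parallel_imp_conductance[of g "r + w"]
        parallel_imp_conductance[of "g * \<tau>" "w / \<tau>\<^sup>2"]
      by (simp only: Some scale_simps series_imp.simps flip: g_def r_def) simp
  qed
qed

text \<open>The common shape of \<open>N10\<close> to \<open>N14\<close>, with the inner resistors
  hidden in the classes \<open>P\<close> and \<open>Q\<close>.\<close>

definition ladder :: "impedance set \<Rightarrow> impedance set \<Rightarrow> impedance set" where
  "ladder P Q = {series_imp r (parallel_imp z w) | r z w. r \<in> resistive \<and> z \<in> P \<and> w \<in> Q}"

lemma Some_0_resistive: "Some 0 \<in> resistive"
  unfolding resistive_def by (auto intro!: exI[of _ 0])

lemma ladderI: "r \<in> resistive \<Longrightarrow> z \<in> P \<Longrightarrow> w \<in> Q \<Longrightarrow> series_imp r (parallel_imp z w) \<in> ladder P Q"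
  unfolding ladder_def by blast

lemma series_resistive: "r \<in> resistive \<Longrightarrow> r' \<in> resistive \<Longrightarrow> series_imp r r' \<in> resistive"
  by (auto simp: resistive_def simp flip: const_add intro: add_nonneg_nonneg)

lemma ladder_series:
  assumes "r \<in> resistive" "y \<in> ladder P Q"
  shows "series_imp r y \<in> ladder P Q"
  using assms ladderI[OF series_resistive[OF assms(1)]]
  by (auto simp: ladder_def simp flip: series_imp_assoc)

text \<open>By \<open>parallel_series_resistor\<close> the new resistor moves inside the series
  resistor, where it joins the branch in \<open>Q\<close>; the rescaling of both branches is
  absorbed by closure under \<open>scale\<close>.\<close>

lemma ladder_parallel:
  assumes r: "r \<in> resistive" and y: "y \<in> ladder P Q"
    and P: "resistive \<subseteq> P" "\<And>z k. k > 0 \<Longrightarrow> z \<in> P \<Longrightarrow> scale k z \<in> P" "\<And>z. Some z \<in> P \<Longrightarrow> 0 \<le> z"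
    and Q: "\<And>z k. k > 0 \<Longrightarrow> z \<in> Q \<Longrightarrow> scale k z \<in> Q" "\<And>z. Some z \<in> Q \<Longrightarrow> 0 \<le> z"
      "\<And>z r. r \<in> resistive \<Longrightarrow> z \<in> Q \<Longrightarrow> parallel_imp r z \<in> Q"
  shows "parallel_imp r y \<in> ladder P Q"
proof -
  obtain r' z w where y': "y = series_imp r' (parallel_imp z w)" "r' \<in> resistive" "z \<in> P" "w \<in> Q"
    using y unfolding ladder_def by blast
  \<comment> \<open>A plain resistor is a ladder whose first branch is shorted.\<close>
  have res: "r'' \<in> ladder P Q" if "r'' \<in> resistive" for r''
    using ladderI[OF that, of "Some 0" P w Q] Some_0_resistive P(1) y'
    by (auto simp: series_imp_commute[of _ "Some 0"])
  consider "r = None" | "r = Some 0" | "r' = None"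
    | S R where "r = Some (const S)" "S > 0" "r' = Some (const R)" "R \<ge> 0"
    using r y'(2) unfolding resistive_def
    by (auto simp: order_le_less)
  then show ?thesis
  proof cases
    case 1
    then show ?thesis using y by simp
  next
    case 2
    then show ?thesis using res Some_0_resistive by simp
  next
    case 3
    then show ?thesis using res r y' by simp
  next
    case (4 S R)
    define G t where "G = 1 / S" and "t = 1 + G * R"
    have G: "G > 0" "t > 0"
      using 4 by (simp_all add: G_def t_def add_pos_nonneg)
    have r_eq: "r = reciprocal (Some (const G))"
      using 4 by (simp add: G_def)
    let ?g = "reciprocal (Some (const (G * t)))"
    have g: "?g \<in> resistive"
      using G by (intro reciprocal_resistive) (auto simp: resistive_def simp del: const_mult)
    have R: "Some (const (R / t)) \<in> resistive"
      using G 4 by (auto simp: resistive_def simp del: const_divide)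
    have k: "0 < 1 / t\<^sup>2"
      using G by simp
    have "0 \<le> x" if "parallel_imp z w = Some x" for x
      using that P(3) Q(2) y' by (cases z; cases w) (auto simp: parallel_imp_Some)
    then have "parallel_imp r y = series_imp (Some (const (R / t)))
        (parallel_imp ?g (scale (1 / t\<^sup>2) (parallel_imp z w)))"
      unfolding y'(1) r_eq 4(3) t_def using parallel_series_resistor[of G R "parallel_imp z w"] G 4
      by simp
    also have "parallel_imp ?g (scale (1 / t\<^sup>2) (parallel_imp z w))
        = parallel_imp (scale (1 / t\<^sup>2) z) (parallel_imp ?g (scale (1 / t\<^sup>2) w))"
      unfolding scale_parallel[OF k] by (rule parallel_imp_left_commute)
    also have "series_imp (Some (const (R / t))) \<dots> \<in> ladder P Q"
      using y' G g by (intro ladderI R P(2) Q(3) Q(1)) auto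
    finally show ?thesis .
  qed
qed

section \<open>Networks with two capacitors and one inductor\<close>

definition RC2L_parallel :: "ratfun \<Rightarrow> impedance set" where
  "RC2L_parallel \<sigma> = ladder (RC1 \<sigma>) (RLC \<sigma>) \<union> ladder (RC2 \<sigma>) (RC1 (1 / \<sigma>))"

text \<open>At \<open>1 / \<sigma>\<close> the ladders have two inductors and one capacitor. Duality
  turns them back into two capacitors and one inductor, now with an outermost series
  connection.\<close>

definition RC2L :: "ratfun \<Rightarrow> impedance set" where
  "RC2L \<sigma> = RC2L_parallel \<sigma> \<union> reciprocal ` RC2L_parallel (1 / \<sigma>)"

lemma RC2L_parallel_series_resistive:
  "r \<in> resistive \<Longrightarrow> y \<in> RC2L_parallel \<sigma> \<Longrightarrow> series_imp r y \<in> RC2L_parallel \<sigma>"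
  unfolding RC2L_parallel_def using ladder_series by blast

lemma RC2L_parallel_parallel_resistive:
  assumes "\<sigma> > 0" "r \<in> resistive" "y \<in> RC2L_parallel \<sigma>"
  shows "parallel_imp r y \<in> RC2L_parallel \<sigma>"
proof -
  have inv: "1 / \<sigma> > 0"
    using assms(1) by simp
  have "parallel_imp r y \<in> ladder (RC1 \<sigma>) (RLC \<sigma>)" if "y \<in> ladder (RC1 \<sigma>) (RLC \<sigma>)"
    using assms(2) that
    by (rule ladder_parallel)
      (use assms(1) resistive_subset_RC1 scale_RC1 scale_RLC RC1_nonneg RLC_nonneg
        parallel_resistive_RLC in blast)+
  moreover have "parallel_imp r y \<in> ladder (RC2 \<sigma>) (RC1 (1 / \<sigma>))"
    if "y \<in> ladder (RC2 \<sigma>) (RC1 (1 / \<sigma>))"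
    using assms(2) that
    by (rule ladder_parallel)
      (use assms(1) inv resistive_subset_RC1 RC1_subset_RC2 scale_RC1 scale_RC2 RC1_nonneg RC2_nonneg
        parallel_resistive_RC1 in blast)+
  ultimately show ?thesis
    using assms(3) unfolding RC2L_parallel_def by blast
qed

lemma reciprocal_RC2L:
  assumes "z \<in> RC2L \<sigma>"
  shows "reciprocal z \<in> RC2L (1 / \<sigma>)"
  using assms unfolding RC2L_def by auto

lemma series_resistive_RC2L:
  assumes "\<sigma> > 0" "r \<in> resistive" "z \<in> RC2L \<sigma>"
  shows "series_imp r z \<in> RC2L \<sigma>"
proof (cases "z \<in> RC2L_parallel \<sigma>")
  case True
  then show ?thesis
    unfolding RC2L_def using assms RC2L_parallel_series_resistive by blast
next
  case False
  then obtain y where y: "y \<in> RC2L_parallel (1 / \<sigma>)" "z = reciprocal y"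
    using assms(3) unfolding RC2L_def by blast
  have "series_imp r z = reciprocal (parallel_imp (reciprocal r) y)"
    by (simp add: y reciprocal_parallel)
  moreover have "parallel_imp (reciprocal r) y \<in> RC2L_parallel (1 / \<sigma>)"
    using assms y by (intro RC2L_parallel_parallel_resistive reciprocal_resistive) auto
  ultimately show ?thesis
    unfolding RC2L_def by blast
qed

lemma parallel_resistive_RC2L:
  assumes "\<sigma> > 0" "r \<in> resistive" "z \<in> RC2L \<sigma>"
  shows "parallel_imp r z \<in> RC2L \<sigma>"
proof (rule parallel_via_reciprocal)
  show "series_imp (reciprocal r) (reciprocal z) \<in> RC2L (1 / \<sigma>)"
    using assms by (intro series_resistive_RC2L reciprocal_resistive reciprocal_RC2L) auto
  show "reciprocal y \<in> RC2L \<sigma>" if "y \<in> RC2L (1 / \<sigma>)" for y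
    using reciprocal_RC2L[OF that] by simp
qed

lemma parallel_RC1_RLC: "z \<in> RC1 \<sigma> \<Longrightarrow> w \<in> RLC \<sigma> \<Longrightarrow> parallel_imp z w \<in> RC2L \<sigma>"
  unfolding RC2L_def RC2L_parallel_def using ladderI[OF Some_0_resistive] by fastforce

lemma parallel_RC2_RL1: "z \<in> RC2 \<sigma> \<Longrightarrow> w \<in> RC1 (1 / \<sigma>) \<Longrightarrow> parallel_imp z w \<in> RC2L \<sigma>"
  unfolding RC2L_def RC2L_parallel_def using ladderI[OF Some_0_resistive] by fastforce

lemma series_RC1_RLC:
  assumes "\<sigma> > 0" "z \<in> RC1 \<sigma>" "w \<in> RLC \<sigma>"
  shows "series_imp z w \<in> RC2L \<sigma>"
proof -
  have "parallel_imp (reciprocal z) (reciprocal w) \<in> RC2L (1 / \<sigma>)"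
    using parallel_RC1_RLC[OF reciprocal_RC1[OF assms(1,2)]] reciprocal_RLC[OF assms(1,3)]
      RLC_inverse[OF assms(1)] by simp
  from reciprocal_RC2L[OF this] show ?thesis
    by (simp add: reciprocal_parallel)
qed

lemma series_RC2_RL1:
  assumes "\<sigma> > 0" "z \<in> RC2 \<sigma>" "w \<in> RC1 (1 / \<sigma>)"
  shows "series_imp z w \<in> RC2L \<sigma>"
proof -
  have "reciprocal w \<in> RC1 (1 / (1 / \<sigma>))"
    using assms by (intro reciprocal_RC1) auto
  then have "parallel_imp (reciprocal z) (reciprocal w) \<in> RC2L (1 / \<sigma>)"
    by (rule parallel_RC2_RL1[OF reciprocal_RC2[OF assms(1,2)]])
  from reciprocal_RC2L[OF this] show ?thesis
    by (simp add: reciprocal_parallel)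
qed

text \<open>The value \<open>UNIV\<close> beyond two capacitors and one inductor lets the structural
  induction run over all networks: a connection that exceeds the bounds satisfies the claim
  trivially, so no bound has to be carried along.\<close>

definition imp_class :: "ratfun \<Rightarrow> nat \<Rightarrow> nat \<Rightarrow> impedance set" where
  "imp_class \<sigma> c l =
    (if c = 0 \<and> l = 0 then resistive else if c = 1 \<and> l = 0 then RC1 \<sigma>
     else if c = 0 \<and> l = 1 then RC1 (1 / \<sigma>) else if c = 2 \<and> l = 0 then RC2 \<sigma>
     else if c = 1 \<and> l = 1 then RLC \<sigma> else if c = 2 \<and> l = 1 then RC2L \<sigma> else UNIV)"

lemma parallel_resistive: "r \<in> resistive \<Longrightarrow> r' \<in> resistive \<Longrightarrow> parallel_imp r r' \<in> resistive"
  by (intro parallel_via_reciprocal[of _ _ resistive] series_resistive reciprocal_resistive)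

lemma imp_class_resistive:
  assumes "\<sigma> > 0" "r \<in> resistive" "z \<in> imp_class \<sigma> c l"
  shows "series_imp r z \<in> imp_class \<sigma> c l" "parallel_imp r z \<in> imp_class \<sigma> c l"
proof -
  have "1 / \<sigma> > 0"
    using assms(1) by simp
  with assms show "series_imp r z \<in> imp_class \<sigma> c l" "parallel_imp r z \<in> imp_class \<sigma> c l"
    by (auto simp: imp_class_def series_resistive parallel_resistive
        series_resistive_RC1 series_resistive_RC2 series_resistive_RLC series_resistive_RC2L
        parallel_resistive_RC1 parallel_resistive_RC2 parallel_resistive_RLC parallel_resistive_RC2L
        split: if_splits)
qed

lemma imp_class_connect:
  assumes "\<sigma> > 0" "z \<in> imp_class \<sigma> c l" "w \<in> imp_class \<sigma> c' l'"
  shows "series_imp z w \<in> imp_class \<sigma> (c + c') (l + l')"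
    and "parallel_imp z w \<in> imp_class \<sigma> (c + c') (l + l')"
proof -
  \<comment> \<open>Up to order, the relevant splittings are: a resistive part with anything, C with
    C, C with L, C with CL, and CC with L. All others exceed the bounds.\<close>
  consider "c = 0 \<and> l = 0" | "c' = 0 \<and> l' = 0"
    | "c = 1 \<and> l = 0 \<and> c' = 1 \<and> l' = 0"
    | "c = 1 \<and> l = 0 \<and> c' = 0 \<and> l' = 1" | "c = 0 \<and> l = 1 \<and> c' = 1 \<and> l' = 0"
    | "c = 1 \<and> l = 0 \<and> c' = 1 \<and> l' = 1" | "c = 1 \<and> l = 1 \<and> c' = 1 \<and> l' = 0"
    | "c = 2 \<and> l = 0 \<and> c' = 0 \<and> l' = 1" | "c = 0 \<and> l = 1 \<and> c' = 2 \<and> l' = 0"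
    | "2 < c + c' \<or> 1 < l + l'"
  proof (cases "2 < c + c' \<or> 1 < l + l'")
    case False
    then have "c = 0 \<or> c = 1 \<or> c = 2" "c' = 0 \<or> c' = 1 \<or> c' = 2" "l = 0 \<or> l = 1" "l' = 0 \<or> l' = 1"
      by linarith+
    with False that show thesis
      by (elim disjE) simp_all
  qed
  then have "series_imp z w \<in> imp_class \<sigma> (c + c') (l + l')
    \<and> parallel_imp z w \<in> imp_class \<sigma> (c + c') (l + l')"
  proof cases
    case 1
    then have "z \<in> resistive"
      using assms(2) by (simp add: imp_class_def)
    then show ?thesis
      using 1 imp_class_resistive[OF assms(1) _ assms(3)] by simp
  next
    case 2
    then have "w \<in> resistive"
      using assms(3) by (simp add: imp_class_def)
    then show ?thesis
      using 2 imp_class_resistive[OF assms(1) _ assms(2)]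
      by (simp add: series_imp_commute[of z] parallel_imp_commute[of z])
  next
    case 3
    then show ?thesis
      using assms series_RC1_RC1 parallel_RC1_RC1 by (simp add: imp_class_def)
  next
    case 4
    then show ?thesis
      using assms series_RC1_RL1 parallel_RC1_RL1 by (simp add: imp_class_def)
  next
    case 5
    then show ?thesis
      using assms series_RC1_RL1 parallel_RC1_RL1
      by (simp add: imp_class_def series_imp_commute[of z] parallel_imp_commute[of z])
  next
    case 6
    then show ?thesis
      using assms series_RC1_RLC parallel_RC1_RLC by (simp add: imp_class_def)
  next
    case 7
    then show ?thesis
      using assms series_RC1_RLC parallel_RC1_RLC
      by (simp add: imp_class_def series_imp_commute[of z] parallel_imp_commute[of z])
  next
    case 8
    then show ?thesis
      using assms series_RC2_RL1 parallel_RC2_RL1 by (simp add: imp_class_def)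
  next
    case 9
    then show ?thesis
      using assms series_RC2_RL1 parallel_RC2_RL1
      by (simp add: imp_class_def series_imp_commute[of z] parallel_imp_commute[of z])
  next
    case 10
    then have "imp_class \<sigma> (c + c') (l + l') = UNIV"
      by (auto simp: imp_class_def)
    then show ?thesis
      by simp
  qed
  then show "series_imp z w \<in> imp_class \<sigma> (c + c') (l + l')"
    and "parallel_imp z w \<in> imp_class \<sigma> (c + c') (l + l')"
    by simp_all
qed

lemma imp_at_class:
  assumes "\<sigma> > 0" "series_parallel N"
  shows "imp_at \<sigma> N \<in> imp_class \<sigma> (num_capacitors N) (num_inductors N)"
  using assms(2)
proof (induction N)
  case (Resistor R)
  then show ?case
    by (auto simp: imp_class_def resistive_def)
next
  case (Conductor G)
  then have "Some (const G) \<in> resistive"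
    by (auto simp: resistive_def)
  then show ?case
    using reciprocal_resistive by (simp add: imp_class_def del: reciprocal.simps)
next
  case (Inductor L)
  have "imp_at \<sigma> (Inductor L) = ratio (lin (1 / \<sigma>) 0 L) (lin (1 / \<sigma>) 1 0)"
    using assms(1) by (simp add: ratio_def lin_def)
  also have "\<dots> \<in> RC1 (1 / \<sigma>)"
    using Inductor by (intro RC1I) auto
  finally show ?case
    by (simp add: imp_class_def)
next
  case (Capacitor C)
  have "imp_at \<sigma> (Capacitor C) = ratio (lin \<sigma> 0 1) (lin \<sigma> C 0)"
    using assms(1) Capacitor by (simp add: ratio_def lin_def)
  also have "\<dots> \<in> RC1 \<sigma>"
    using Capacitor by (intro RC1I) auto
  finally show ?case
    by (simp add: imp_class_def)
qed (use imp_class_connect[OF assms(1)] in auto)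


subsection \<open>Realization\<close>

text \<open>An admittance \<open>y\<close> in parallel adds \<open>y * n\<close> to the denominator.
  Read backwards, subtracting \<open>y * n\<close> from a denominator extracts a shunt
  element.\<close>

lemma parallel_ratio:
  assumes "n \<noteq> 0 \<or> d \<noteq> 0"
  shows "parallel_imp (reciprocal (Some y)) (ratio n d) = ratio n (d + y * n)"
proof -
  have y: "Some y = ratio y 1"
    by (simp add: ratio_def)
  have "parallel_imp (reciprocal (Some y)) (ratio n d) = reciprocal (series_imp (ratio y 1) (ratio d n))"
    using assms by (simp only: parallel_imp_def reciprocal_reciprocal y reciprocal_ratio)
  also have "\<dots> = reciprocal (ratio (d + y * n) n)"
    by (simp add: series_imp_ratio add.commute)
  also have "\<dots> = ratio n (d + y * n)"
    using assms by (intro reciprocal_ratio) auto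
  finally show ?thesis .
qed

lemma imp_at_RC:
  assumes "\<sigma> > 0" "G \<ge> 0" "C > 0"
  shows "imp_at \<sigma> (Conductor G \<parallel> Capacitor C) = Some (1 / (const C * \<sigma> + const G))"
proof -
  have "const C * \<sigma> > 0" "const C * \<sigma> + const G > 0" "1 + const G / (const C * \<sigma>) > 0"
    using assms by (simp_all add: add_pos_nonneg)
  then show ?thesis
    using parallel_imp_conductance[of "const G" "1 / (const C * \<sigma>)"] assms
    by (simp add: field_simps del: reciprocal.simps)
qed

text \<open>\<open>N1\<close> contains no open circuit, so that case stays as a separate alternative
  until the final step, where the impedance is finite.\<close>

lemma resistive_realization: "r \<in> resistive \<Longrightarrow> r = None \<or> r \<in> imp_at \<sigma> ` N1"
  unfolding resistive_def N1_def by force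

lemma RC1_realization:
  assumes "\<sigma> > 0" "z \<in> RC1 \<sigma>"
  shows "z = None \<or> z \<in> imp_at \<sigma> ` (N1 \<union> N2)"
  using assms
proof (cases rule: RC1_cases)
  case 1
  then show ?thesis
    using resistive_realization[of z \<sigma>] by blast
next
  case (2 R G C)
  then have "z = imp_at \<sigma> (Resistor R \<oplus> (Conductor G \<parallel> Capacitor C))"
    using imp_at_RC[OF assms(1)] by simp
  then show ?thesis
    using 2 unfolding N2_def by blast
qed

lemma imp_at_inverse_image: "imp_at (1 / \<sigma>) ` \<N> = imp_at \<sigma> ` freq_inv ` \<N>"
  by (simp add: image_image imp_at_freq_inv)

lemma freq_inv_N1: "freq_inv ` N1 \<subseteq> N1"
  and freq_inv_N2: "freq_inv ` N2 \<subseteq> N3"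
  and freq_inv_N6: "freq_inv ` N6 \<subseteq> N7"
  by (auto simp: N1_def N2_def N3_def N6_def N7_def)

lemma RL1_realization:
  assumes "\<sigma> > 0" "z \<in> RC1 (1 / \<sigma>)"
  shows "z = None \<or> z \<in> imp_at \<sigma> ` (N1 \<union> N3)"
proof -
  have "z = None \<or> z \<in> imp_at \<sigma> ` freq_inv ` (N1 \<union> N2)"
    using RC1_realization[OF _ assms(2)] assms(1) unfolding imp_at_inverse_image by simp
  then show ?thesis
    using freq_inv_N1 freq_inv_N2 by blast
qed

lemma Capacitor_RC1:
  assumes "\<sigma> > 0" "C > 0"
  shows "imp_at \<sigma> (Capacitor C) \<in> RC1 \<sigma>"
  using imp_at_class[of \<sigma> "Capacitor C"] assms by (simp add: imp_class_def)

lemma Inductor_RL1: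
  assumes "\<sigma> > 0" "L > 0"
  shows "imp_at \<sigma> (Inductor L) \<in> RC1 (1 / \<sigma>)"
  using imp_at_class[of \<sigma> "Inductor L"] assms by (simp add: imp_class_def)

text \<open>The form \<open>N4\<close> demands a positive inner resistor. If it is zero, the two
  capacitors are in parallel and merge into one of capacitance \<open>C + C2\<close>; if
  \<open>x\<close> is resistive, only \<open>C2\<close> remains.\<close>

lemma RC2_realization_step:
  assumes "\<sigma> > 0" "R1 \<ge> 0" "C2 > 0" "x \<in> RC1 \<sigma>"
    and z: "z = series_imp (Some (const R1)) (parallel_imp (imp_at \<sigma> (Capacitor C2)) x)"
  shows "z \<in> RC1 \<sigma> \<union> imp_at \<sigma> ` N4"
proof -
  have R1: "Some (const R1) \<in> resistive"
    using assms(2) by (auto simp: resistive_def)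
  note cap = Capacitor_RC1[OF assms(1,3)]
  from assms(1,4) show ?thesis
  proof (cases rule: RC1_cases)
    case 1
    have "z \<in> RC1 \<sigma>"
      unfolding z parallel_imp_commute[of _ x]
      by (intro series_resistive_RC1 parallel_resistive_RC1 assms(1) R1 1 cap)
    then show ?thesis ..
  next
    case (2 R G C)
    show ?thesis
    proof (cases "R = 0")
      case True
      have "x = imp_at \<sigma> (Conductor G \<parallel> Capacitor C)"
        using imp_at_RC[OF assms(1)] 2 True by simp
      moreover have "parallel_imp (imp_at \<sigma> (Capacitor C)) (imp_at \<sigma> (Capacitor C2))
        = imp_at \<sigma> (Capacitor (C + C2))"
      proof -
        have "\<sigma> * const C2 + \<sigma> * const C > 0"
          using assms 2 by (intro add_pos_pos) auto
        then show ?thesis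
          using assms(1,3) 2(3) by (simp add: parallel_imp_def algebra_simps less_imp_neq[symmetric])
      qed
      ultimately have "parallel_imp (imp_at \<sigma> (Capacitor C2)) x
          = parallel_imp (imp_at \<sigma> (Conductor G)) (imp_at \<sigma> (Capacitor (C + C2)))"
        by (simp add: parallel_imp_commute[of _ "parallel_imp _ _"] parallel_imp_assoc
            del: imp_at.simps(2,4))
      moreover have "imp_at \<sigma> (Conductor G) \<in> resistive"
        using imp_at_class[OF assms(1), of "Conductor G"] 2 by (simp add: imp_class_def)
      ultimately have "z \<in> RC1 \<sigma>"
        unfolding z using assms 2 R1
        by (auto intro!: series_resistive_RC1 parallel_resistive_RC1 Capacitor_RC1 simp del: imp_at.simps)
      then show ?thesis ..
    next
      case False
      have "z = imp_at \<sigma> (Resistor R1 \<oplus> (Capacitor C2 \<parallel> (Resistor R \<oplus> (Conductor G \<parallel> Capacitor C))))"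
        using imp_at_RC[OF assms(1)] 2 unfolding z by simp
      moreover have "\<dots> \<in> imp_at \<sigma> ` N4"
        unfolding N4_def using 2 False assms by (intro imageI) force
      ultimately show ?thesis
        by simp
    qed
  qed
qed

text \<open>Extraction at infinity: the value \<open>A / D\<close> becomes a series resistor, the
  pole at infinity of the remaining admittance becomes a shunt capacitor, and the rest is
  bilinear.\<close>

lemma RC2_realization:
  assumes "\<sigma> > 0" "z \<in> RC2 \<sigma>"
  shows "z \<in> RC1 \<sigma> \<union> imp_at \<sigma> ` N4"
proof -
  obtain A B C D E F where z: "z = ratio (quad \<sigma> A B C) (quad \<sigma> D E F)"
    and rc: "rc_coeffs A B C D E F"
    using assms(2) unfolding RC2_def by blast
  define P Q T where PQT: "P = B * D - A * E" "Q = C * D - A * F" "T = C * E - B * F"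
  have nn: "0 \<le> A" "0 \<le> B" "0 \<le> C" "0 \<le> D" "0 \<le> E" "0 \<le> F" "0 < A + B + C + D + E + F"
    using rc unfolding rc_coeffs_def nonneg_coeffs_def by auto
  have "A * E - B * D = - P" "A * F - C * D = - Q" "B * F - C * E = - T"
    by (simp_all add: PQT)
  note iff = rc_coeffs_iff[OF this]
  have PQT_nn: "0 \<le> P" "0 \<le> Q" "0 \<le> T" "Q\<^sup>2 \<le> P * T"
    using rc unfolding iff by simp_all
  \<comment> \<open>Expansion of the vanishing determinant with rows \<open>A B C\<close>,
    \<open>D E F\<close>, \<open>D E F\<close>.\<close>
  have pluecker: "P * F = Q * E - T * D"
    by (simp add: PQT algebra_simps)
  show ?thesis
  proof (cases "D = 0")
    case True
    show ?thesis
    proof (cases "E = 0 \<and> F = 0")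
      case True
      with \<open>D = 0\<close> have "z = None"
        by (simp add: z ratio_def quad_def)
      then show ?thesis
        using None_in_RC1[OF assms(1)] by simp
    next
      case False
      \<comment> \<open>With \<open>D = 0\<close> the signs of the minors force \<open>A = 0\<close>
        as well, so that both quadratics are linear.\<close>
      have "A * E = 0" "A * F = 0"
        using PQT_nn(1,2) True mult_nonneg_nonneg[OF nn(1) nn(5)] mult_nonneg_nonneg[OF nn(1) nn(6)]
        unfolding PQT by simp_all
      then have "A = 0"
        using False by auto
      then have "z = ratio (lin \<sigma> B C) (lin \<sigma> E F)"
        using True by (simp add: z quad_def lin_def)
      also have "\<dots> \<in> RC1 \<sigma>"
        using nn PQT_nn True \<open>A = 0\<close> unfolding PQT by (intro RC1I) auto
      finally show ?thesis ..
    qed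
  next
    case False
    then have D: "D > 0"
      using nn by simp
    have coeffs: "B = P / D + A / D * E" "C = Q / D + A / D * F"
      using D by (simp_all add: PQT field_simps)
    have z1: "z = series_imp (Some (const (A / D))) (ratio (quad \<sigma> 0 (P / D) (Q / D)) (quad \<sigma> D E F))"
      unfolding series_imp_quad[OF assms(1)] z using D coeffs by simp
    show ?thesis
    proof (cases "P = 0")
      case True
      then have "Q = 0"
        using PQT_nn by simp
      then have "z = Some (const (A / D))"
        using True D nn assms(1) by (simp add: z1 ratio_def quad_eq_0_iff)
      also have "\<dots> \<in> resistive"
        using nn D by (auto simp: resistive_def simp del: const_divide)
      finally show ?thesis
        using resistive_subset_RC1[OF assms(1)] by blast
    next
      case False
      then have P: "P > 0"
        using PQT_nn by simp
      \<comment> \<open>For large \<sigma> the admittance of the remainder grows like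
        \<open>D\<^sup>2 / P * \<sigma>\<close>. Removing a capacitor of that size cancels the
        quadratic term of the denominator and lowers \<open>E\<close> to \<open>E'\<close>.\<close>
      define E' x where "E' = E - D * Q / P" and "x = ratio (lin \<sigma> (P / D) (Q / D)) (lin \<sigma> E' F)"
      have "D * Q \<le> E * P"
      proof (cases "Q = 0")
        case False
        have "Q * (D * Q) = D * Q\<^sup>2"
          by (simp add: power2_eq_square)
        also have "\<dots> \<le> D * (P * T)"
          using PQT_nn D by (intro mult_left_mono) auto
        also have "\<dots> \<le> P * (T * D) + P * (P * F)"
          using P nn by simp
        also have "\<dots> = Q * (E * P)"
          unfolding pluecker by (simp add: algebra_simps)
        finally show ?thesis
          using False PQT_nn by simp
      qed (use nn P in simp)
      then have E': "E' \<ge> 0"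
        using P by (simp add: E'_def field_simps)
      \<comment> \<open>The class inequality for \<open>x\<close>. Once \<open>P * F\<close> is
        rewritten by \<open>pluecker\<close>, it is the resultant condition
        \<open>Q\<^sup>2 \<le> P * T\<close>.\<close>
      have "P * F * P \<le> Q * (E * P - D * Q)"
      proof -
        have "P * F * P = Q * (E * P) - D * (P * T)"
          unfolding pluecker by (simp add: algebra_simps)
        also have "\<dots> \<le> Q * (E * P) - D * Q\<^sup>2"
          using PQT_nn D by (simp add: mult_left_mono)
        also have "\<dots> = Q * (E * P - D * Q)"
          by (simp add: algebra_simps power2_eq_square)
        finally show ?thesis .
      qed
      then have "P * F \<le> Q * E'"
        using P by (simp add: E'_def field_simps)
      then have "P / D * F \<le> Q / D * E'"
        using D by (simp add: field_simps)
      then have x: "x \<in> RC1 \<sigma>"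
        unfolding x_def using P D PQT_nn E' nn by (intro RC1I) (simp_all add: add_pos_nonneg)
      have "lin \<sigma> (P / D) (Q / D) \<noteq> 0"
        using P D PQT_nn assms(1) by (simp add: lin_eq_0_iff)
      moreover have "lin \<sigma> E' F + const (D\<^sup>2 / P) * \<sigma> * lin \<sigma> (P / D) (Q / D) = quad \<sigma> D E F"
      proof -
        have "const D \<noteq> 0" "const P \<noteq> 0"
          using P D by simp_all
        then show ?thesis
          by (simp add: lin_def quad_def E'_def power2_eq_square field_simps)
      qed
      ultimately have "parallel_imp (reciprocal (Some (const (D\<^sup>2 / P) * \<sigma>))) x
          = ratio (lin \<sigma> (P / D) (Q / D)) (quad \<sigma> D E F)"
        unfolding x_def using parallel_ratio by metis
      moreover have "imp_at \<sigma> (Capacitor (D\<^sup>2 / P)) = reciprocal (Some (const (D\<^sup>2 / P) * \<sigma>))"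
        using P D assms(1) by simp
      moreover have "quad \<sigma> 0 (P / D) (Q / D) = lin \<sigma> (P / D) (Q / D)"
        by (simp add: quad_def lin_def)
      ultimately have "z = series_imp (Some (const (A / D)))
          (parallel_imp (imp_at \<sigma> (Capacitor (D\<^sup>2 / P))) x)"
        unfolding z1 by (simp only:)
      with assms(1) _ _ x show ?thesis
        by (rule RC2_realization_step) (use P D nn in auto)
    qed
  qed
qed

lemma bilinear_RC1_or_RL1:
  assumes "\<sigma> > 0" "0 \<le> a" "0 \<le> b" "0 \<le> c" "0 \<le> d" "0 < a + b + c + d"
  shows "ratio (lin \<sigma> a b) (lin \<sigma> c d) \<in> RC1 \<sigma> \<union> RC1 (1 / \<sigma>)"
proof (cases "a * d \<le> b * c")
  case True
  then show ?thesis
    using assms RC1I by simp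
next
  case False
  have "ratio (lin \<sigma> a b) (lin \<sigma> c d) = ratio (lin (1 / \<sigma>) b a * \<sigma>) (lin (1 / \<sigma>) d c * \<sigma>)"
    using assms(1) by (simp add: lin_inverse)
  also have "\<dots> = ratio (lin (1 / \<sigma>) b a) (lin (1 / \<sigma>) d c)"
    using assms(1) by (simp add: ratio_cancel)
  also have "\<dots> \<in> RC1 (1 / \<sigma>)"
    using assms False by (intro RC1I) (simp_all add: ac_simps)
  finally show ?thesis ..
qed

text \<open>The same extraction at \<sigma> = 0: the value \<open>C / F\<close> becomes a series
  resistor and the pole of the remaining admittance at 0 becomes a shunt inductor. The alternative
  \<open>lam\<close> makes the new coefficient \<open>E'\<close> nonnegative, and the resultant
  condition makes the bilinear rest an RC impedance.\<close>

lemma RLC_realization_N6: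
  assumes "\<sigma> > 0" "nonneg_coeffs A B C D E F"
    and res: "(A * E - B * D) * (B * F - C * E) \<le> (A * F - C * D)\<^sup>2"
    and q0: "C * D \<le> A * F" and lam: "F * (A * F - C * D) \<le> E * (B * F - C * E)"
    and z: "z = ratio (quad \<sigma> A B C) (quad \<sigma> D E F)"
  shows "z \<in> RC1 \<sigma> \<union> RC1 (1 / \<sigma>) \<union> imp_at \<sigma> ` N6"
proof -
  have nn: "0 \<le> A" "0 \<le> B" "0 \<le> C" "0 \<le> D" "0 \<le> E" "0 \<le> F" "0 < A + B + C + D + E + F"
    using assms(2) unfolding nonneg_coeffs_def by auto
  define p q r where pqr: "p = A * E - B * D" "q = A * F - C * D" "r = B * F - C * E"
  have hyp: "0 \<le> q" "p * r \<le> q\<^sup>2" "F * q \<le> E * r"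
    using res q0 lam by (simp_all add: pqr)
  have pluecker: "p * F = q * E - r * D"
    by (simp add: pqr algebra_simps)
  show ?thesis
  proof (cases "F = 0")
    case F: True
    show ?thesis
    proof (cases "D = 0 \<and> E = 0")
      case True
      then have "z = None"
        using F by (simp add: z ratio_def quad_def)
      then show ?thesis
        using None_in_RC1[OF assms(1)] by simp
    next
      case False
      \<comment> \<open>With \<open>F = 0\<close> the hypotheses force \<open>C = 0\<close>, so
        \<sigma> cancels and a bilinear function of either kind remains.\<close>
      have "C * D = 0" "C * E\<^sup>2 = 0"
        using hyp(1,3) F mult_nonneg_nonneg[OF nn(3) nn(4)]
          mult_nonneg_nonneg[OF nn(3) zero_le_power2[of E]]
        unfolding pqr by (simp_all add: power2_eq_square mult.left_commute)
      then have "C = 0"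
        using False by auto
      then have "z = ratio (lin \<sigma> A B * \<sigma>) (lin \<sigma> D E * \<sigma>)"
        using F by (simp add: z quad_def lin_def algebra_simps power2_eq_square)
      also have "\<dots> = ratio (lin \<sigma> A B) (lin \<sigma> D E)"
        using assms(1) by (simp add: ratio_cancel)
      also have "\<dots> \<in> RC1 \<sigma> \<union> RC1 (1 / \<sigma>)"
        using nn F \<open>C = 0\<close> by (intro bilinear_RC1_or_RL1 assms(1)) auto
      finally show ?thesis
        by blast
    qed
  next
    case False
    then have F: "F > 0"
      using nn by simp
    have r: "r \<ge> 0"
    proof (cases "E = 0")
      case True
      then show ?thesis
        using nn by (simp add: pqr)
    next
      case False
      have "0 \<le> E * r"
        using hyp F by (meson mult_nonneg_nonneg order_less_imp_le order_trans)
      then show ?thesis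
        using False nn by (simp add: zero_le_mult_iff)
    qed
    have R1: "Some (const (C / F)) \<in> resistive"
      using nn F by (auto simp: resistive_def simp del: const_divide)
    have coeffs: "A = q / F + C / F * D" "B = r / F + C / F * E"
      using F by (simp_all add: pqr field_simps)
    have z1: "z = series_imp (Some (const (C / F))) (ratio (quad \<sigma> (q / F) (r / F) 0) (quad \<sigma> D E F))"
      unfolding series_imp_quad[OF assms(1)] z using F coeffs by simp
    show ?thesis
    proof (cases "r = 0")
      case True
      then have "q = 0"
        using hyp F by (simp add: mult_le_0_iff)
      then have "z = Some (const (C / F))"
        using True F nn assms(1) by (simp add: z1 ratio_def quad_eq_0_iff)
      then show ?thesis
        using R1 resistive_subset_RC1[OF assms(1)] by blast
    next
      case False
      with r have r: "r > 0" by simp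
      \<comment> \<open>Near \<sigma> = 0 the remaining admittance behaves like
        \<open>F\<^sup>2 / (r * \<sigma>)\<close>, that of an inductor \<open>r / F\<^sup>2\<close>;
        removing it cancels the constant term of the denominator.\<close>
      define E' x where "E' = E - F * q / r" and "x = ratio (lin \<sigma> (q / F) (r / F)) (lin \<sigma> D E')"
      have E': "E' \<ge> 0"
        using r hyp by (simp add: E'_def field_simps)
      have "q * (E * r - F * q) \<le> r * (D * r)"
      proof -
        have "q * (E * r - F * q) = r * (q * E) - F * q\<^sup>2"
          by (simp add: algebra_simps power2_eq_square)
        also have "\<dots> \<le> r * (q * E) - F * (p * r)"
          using hyp F by simp
        also have "\<dots> = r * (q * E - p * F)"
          by (simp add: algebra_simps)
        also have "\<dots> = r * (D * r)"
          unfolding pluecker by (simp add: algebra_simps)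
        finally show ?thesis .
      qed
      then have "q * E' \<le> r * D"
        using r by (simp add: E'_def field_simps)
      then have "q / F * E' \<le> r / F * D"
        using F by (simp add: field_simps)
      then have x: "x \<in> RC1 \<sigma>"
        unfolding x_def using r F hyp E' nn by (intro RC1I) (simp_all add: add_pos_nonneg add_nonneg_pos)
      have "lin \<sigma> (q / F) (r / F) \<noteq> 0"
        using r F hyp assms(1) by (simp add: lin_eq_0_iff)
      moreover have "lin \<sigma> D E' + 1 / (const (r / F\<^sup>2) * \<sigma>) * lin \<sigma> (q / F) (r / F) = quad \<sigma> D E F / \<sigma>"
      proof -
        have "const F \<noteq> 0" "const r \<noteq> 0"
          using r F by simp_all
        then show ?thesis
          using assms(1) by (simp add: lin_def quad_def E'_def power2_eq_square field_simps)
      qed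
      ultimately have "parallel_imp (reciprocal (Some (1 / (const (r / F\<^sup>2) * \<sigma>)))) x
          = ratio (lin \<sigma> (q / F) (r / F)) (quad \<sigma> D E F / \<sigma>)"
        unfolding x_def using parallel_ratio by metis
      also have "\<dots> = ratio (lin \<sigma> (q / F) (r / F) * \<sigma>) (quad \<sigma> D E F / \<sigma> * \<sigma>)"
        using assms(1) by (simp only: ratio_cancel)
      also have "\<dots> = ratio (quad \<sigma> (q / F) (r / F) 0) (quad \<sigma> D E F)"
      proof -
        have "lin \<sigma> (q / F) (r / F) * \<sigma> = quad \<sigma> (q / F) (r / F) 0"
          by (simp add: lin_def quad_def algebra_simps power2_eq_square)
        then show ?thesis
          using assms(1) by simp
      qed
      finally have "ratio (quad \<sigma> (q / F) (r / F) 0) (quad \<sigma> D E F)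
          = parallel_imp (reciprocal (Some (1 / (const (r / F\<^sup>2) * \<sigma>)))) x" ..
      moreover have L: "r / F\<^sup>2 > 0"
        using r F by simp
      moreover have "imp_at \<sigma> (Inductor (r / F\<^sup>2)) = reciprocal (Some (1 / (const (r / F\<^sup>2) * \<sigma>)))"
        using r F assms(1) by simp
      ultimately have z2: "z = series_imp (Some (const (C / F)))
          (parallel_imp (imp_at \<sigma> (Inductor (r / F\<^sup>2))) x)"
        unfolding z1 by (simp only:)
      from assms(1) x show ?thesis
      proof (cases rule: RC1_cases)
        case 1
        have "z \<in> RC1 (1 / \<sigma>)"
          unfolding z2 parallel_imp_commute[of _ x] using assms(1)
          by (intro series_resistive_RC1 parallel_resistive_RC1 R1 1 Inductor_RL1 L) auto
        then show ?thesis by simp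
      next
        case (2 R G C')
        then have "z = imp_at \<sigma> (Resistor (C / F) \<oplus>
            (Inductor (r / F\<^sup>2) \<parallel> (Resistor R \<oplus> (Conductor G \<parallel> Capacitor C'))))"
          using imp_at_RC[OF assms(1)] unfolding z2 by simp
        moreover have "\<dots> \<in> imp_at \<sigma> ` N6"
          unfolding N6_def using 2 nn F L by (intro imageI) force
        ultimately show ?thesis
          by simp
      qed
    qed
  qed
qed

text \<open>The second alternative in \<open>lam\<close> is the first one for the reversed
  coefficients, that is, at \<open>1 / \<sigma>\<close>, where an \<open>N6\<close> network is an
  \<open>N7\<close> network at \<sigma>.\<close>

lemma RLC_realization_N6_N7:
  assumes "\<sigma> > 0" "nonneg_coeffs A B C D E F"
    and pqr: "p = A * E - B * D" "q = A * F - C * D" "r = B * F - C * E"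
    and res: "p * r \<le> q\<^sup>2"
    and lam: "0 \<le> q \<and> F * q \<le> E * r \<or> q \<le> 0 \<and> E * p \<le> D * q"
    and z: "z = ratio (quad \<sigma> A B C) (quad \<sigma> D E F)"
  shows "z \<in> RC1 \<sigma> \<union> RC1 (1 / \<sigma>) \<union> imp_at \<sigma> ` (N6 \<union> N7)"
  using lam
proof
  assume "0 \<le> q \<and> F * q \<le> E * r"
  then have "z \<in> RC1 \<sigma> \<union> RC1 (1 / \<sigma>) \<union> imp_at \<sigma> ` N6"
    using res unfolding pqr by (intro RLC_realization_N6[OF assms(1,2) _ _ _ z]) auto
  then show ?thesis by blast
next
  assume "q \<le> 0 \<and> E * p \<le> D * q"
  moreover have "C * E - B * F = - r" "C * D - A * F = - q" "B * D - A * E = - p"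
    by (simp_all add: pqr)
  moreover have "z = ratio (quad (1 / \<sigma>) C B A) (quad (1 / \<sigma>) F E D)"
    using assms(1) by (simp add: ratio_quad_inverse z)
  ultimately have "z \<in> RC1 (1 / \<sigma>) \<union> RC1 (1 / (1 / \<sigma>)) \<union> imp_at (1 / \<sigma>) ` N6"
    using assms(1) res
    by (intro RLC_realization_N6[OF _ nonneg_coeffs_rev[OF assms(2)]]) (auto simp: mult.commute)
  then show ?thesis
    using freq_inv_N6 unfolding imp_at_inverse_image by auto
qed

lemma dual_N6: "dual ` N6 \<subseteq> N8"
  and dual_N7: "dual ` N7 \<subseteq> N9"
  by (auto simp: N6_def N7_def N8_def N9_def)

lemma N6_series_parallel: "N \<in> N6 \<Longrightarrow> series_parallel N"
  and N7_series_parallel: "N \<in> N7 \<Longrightarrow> series_parallel N"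
  by (auto simp: N6_def N7_def)

text \<open>The second and fourth alternatives of \<open>regular_coeffs\<close> are the third and
  first for the reciprocal, whence the duals \<open>N9\<close> of \<open>N7\<close> and
  \<open>N8\<close> of \<open>N6\<close>.\<close>

lemma RLC_realization:
  assumes "\<sigma> > 0" "z \<in> RLC \<sigma>"
  shows "z \<in> RC1 \<sigma> \<union> RC1 (1 / \<sigma>) \<union> imp_at \<sigma> ` (N6 \<union> N7 \<union> N8 \<union> N9)"
proof -
  obtain A B C D E F where z: "z = ratio (quad \<sigma> A B C) (quad \<sigma> D E F)"
    and reg: "regular_coeffs A B C D E F"
    using assms(2) unfolding RLC_def by blast
  define p q r where pqr: "p = A * E - B * D" "q = A * F - C * D" "r = B * F - C * E"
  note iff = regular_coeffs_iff[OF pqr[symmetric]]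
  have nn: "nonneg_coeffs A B C D E F" and res: "p * r \<le> q\<^sup>2"
    using reg unfolding iff by auto
  consider "0 \<le> q \<and> F * q \<le> E * r \<or> q \<le> 0 \<and> E * p \<le> D * q"
    | "0 \<le> - q \<and> C * (- q) \<le> B * (- r) \<or> - q \<le> 0 \<and> B * (- p) \<le> A * (- q)"
    using reg unfolding iff by auto
  then show ?thesis
  proof cases
    case 1
    then show ?thesis
      using RLC_realization_N6_N7[OF assms(1) nn pqr res _ z] by blast
  next
    case 2
    have "reciprocal z = ratio (quad \<sigma> D E F) (quad \<sigma> A B C)"
      unfolding z by (rule reciprocal_ratio[OF quad_nz_cases[OF assms(1) nn]])
    moreover have "- p = D * B - E * A" "- q = D * C - F * A" "- r = E * C - F * B"
      by (simp_all add: pqr mult.commute)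
    moreover have "- p * - r \<le> (- q)\<^sup>2"
      using res by simp
    ultimately have "reciprocal z \<in> RC1 \<sigma> \<union> RC1 (1 / \<sigma>) \<union> imp_at \<sigma> ` (N6 \<union> N7)"
      using 2 by (intro RLC_realization_N6_N7[OF assms(1) nonneg_coeffs_swap[OF nn]])
    then consider "reciprocal z \<in> RC1 \<sigma>" | "reciprocal z \<in> RC1 (1 / \<sigma>)"
      | N where "N \<in> N6 \<union> N7" "reciprocal z = imp_at \<sigma> N"
      by blast
    then show ?thesis
    proof cases
      case 1
      then show ?thesis
        using reciprocal_RC1[OF assms(1), of "reciprocal z"] by simp
    next
      case 2
      then show ?thesis
        using reciprocal_RC1[of "1 / \<sigma>" "reciprocal z"] assms(1) by simp
    next
      case (3 N)
      then have "z = imp_at \<sigma> (dual N)"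
        using imp_at_dual[OF assms(1), of N] N6_series_parallel N7_series_parallel
        by (metis Un_iff reciprocal_reciprocal)
      moreover have "dual N \<in> N8 \<union> N9"
        using 3 dual_N6 dual_N7 by blast
      ultimately show ?thesis
        by blast
    qed
  qed
qed


text \<open>
  In a parallel connection the resistive part \<open>g\<close> can be moved over to the other branch, whose
  class is closed under it.
\<close>

lemma RL1_cases_parallel:
  assumes "\<sigma> > 0" "z \<in> RC1 (1 / \<sigma>)"
  obtains "z \<in> resistive"
  | g R L where "g \<in> resistive" "R \<ge> 0" "L > 0"
    "z = parallel_imp g (imp_at \<sigma> (Resistor R \<oplus> Inductor L))"
proof -
  \<comment> \<open>Partial fractions are applied to the admittance, so that the resistor comes out
    in parallel rather than in series.\<close>
  have "reciprocal z \<in> RC1 \<sigma>"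
    using reciprocal_RC1[of "1 / \<sigma>" z] assms by simp
  with assms(1) show thesis
  proof (cases rule: RC1_cases)
    case 1
    then show thesis
      using that(1) reciprocal_resistive[of "reciprocal z"] by simp
  next
    case (2 R G C)
    have sp: "series_parallel (Resistor R \<oplus> (Conductor G \<parallel> Capacitor C))"
      using 2 by simp
    have "z = reciprocal (imp_at \<sigma> (Resistor R \<oplus> (Conductor G \<parallel> Capacitor C)))"
      using 2 imp_at_RC[OF assms(1)] by (metis imp_at.simps(1,5) reciprocal_reciprocal series_imp.simps(1))
    also have "\<dots> = imp_at \<sigma> (Conductor R \<parallel> (Resistor G \<oplus> Inductor C))"
      using imp_at_dual[OF assms(1) sp] by simp
    finally have "z = parallel_imp (imp_at \<sigma> (Conductor R)) (imp_at \<sigma> (Resistor G \<oplus> Inductor C))"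
      by simp
    moreover have "imp_at \<sigma> (Conductor R) \<in> resistive"
      using imp_at_class[OF assms(1), of "Conductor R"] 2 by (simp add: imp_class_def)
    ultimately show thesis
      using that(2) 2 by blast
  qed
qed

lemma series_Resistor_Inductor_RL1:
  assumes "\<sigma> > 0" "R \<ge> 0" "L > 0"
  shows "imp_at \<sigma> (Resistor R \<oplus> Inductor L) \<in> RC1 (1 / \<sigma>)"
  using imp_at_class[OF assms(1), of "Resistor R \<oplus> Inductor L"] assms by (simp add: imp_class_def)

text \<open>Stated for two inductors and one capacitor, for which \<open>N10\<close> to
  \<open>N13\<close> are the networks as written. If the second branch needs only one reactive
  element, the whole lies in \<open>RLC\<close> or in the RL class
  \<open>RC2 (1 / \<sigma>)\<close>.\<close>

lemma RL1_RLC_ladder_realization: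
  assumes \<sigma>: "\<sigma> > 0" and y: "y \<in> ladder (RC1 (1 / \<sigma>)) (RLC \<sigma>)"
  shows "y \<in> RLC \<sigma> \<union> RC2 (1 / \<sigma>) \<union> imp_at \<sigma> ` (N10 \<union> N11 \<union> N12 \<union> N13)"
proof -
  have inv: "1 / \<sigma> > 0"
    using \<sigma> by simp
  obtain r x w where y': "y = series_imp r (parallel_imp x w)"
    and rxw: "r \<in> resistive" "x \<in> RC1 (1 / \<sigma>)" "w \<in> RLC \<sigma>"
    using y unfolding ladder_def by blast
  show ?thesis
  proof (cases "r = None")
    case True
    then show ?thesis
      using None_in_RLC[OF \<sigma>] by (simp add: y')
  next
    case False
    then obtain R4 where R4: "r = imp_at \<sigma> (Resistor R4)" "R4 \<ge> 0"
      using rxw(1) by (auto simp: resistive_def)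
    from \<sigma> rxw(2) show ?thesis
    proof (cases rule: RL1_cases_parallel)
      case 1
      then show ?thesis
        unfolding y' using \<sigma> rxw by (intro UnI1 series_resistive_RLC parallel_resistive_RLC)
    next
      case (2 g R5 L2)
      let ?b = "Resistor R5 \<oplus> Inductor L2"
      note b = series_Resistor_Inductor_RL1[OF \<sigma> 2(2,3)]
      define w' where "w' = parallel_imp g w"
      have y'': "y = series_imp r (parallel_imp (imp_at \<sigma> ?b) w')"
        unfolding y' 2(4) w'_def parallel_imp_assoc by (simp only: parallel_imp_left_commute[of g])
      have "w' \<in> RLC \<sigma>"
        unfolding w'_def using \<sigma> 2(1) rxw(3) by (rule parallel_resistive_RLC)
      from RLC_realization[OF \<sigma> this] consider "w' \<in> RC1 \<sigma>" | "w' \<in> RC1 (1 / \<sigma>)"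
        | N where "N \<in> N6" "w' = imp_at \<sigma> N" | N where "N \<in> N7" "w' = imp_at \<sigma> N"
        | N where "N \<in> N8" "w' = imp_at \<sigma> N" | N where "N \<in> N9" "w' = imp_at \<sigma> N"
        by blast
      then show ?thesis
      proof cases
        case 1
        have "y \<in> RLC \<sigma>"
          unfolding y'' parallel_imp_commute[of _ w']
          using \<sigma> rxw(1) 1 b by (intro series_resistive_RLC parallel_RC1_RL1)
        then show ?thesis by simp
      next
        case 2
        have "y \<in> RC2 (1 / \<sigma>)"
          unfolding y'' using inv rxw(1) 2 b by (intro series_resistive_RC2 parallel_RC1_RC1)
        then show ?thesis by simp
      next
        case (3 N)
        have "y = imp_at \<sigma> (Resistor R4 \<oplus> (?b \<parallel> N))"
          by (simp add: y'' R4 3)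
        moreover have "Resistor R4 \<oplus> (?b \<parallel> N) \<in> N10"
          using 3(1) 2(2,3) R4(2) unfolding N6_def N10_def by blast
        ultimately show ?thesis by blast
      next
        case (4 N)
        have "y = imp_at \<sigma> (Resistor R4 \<oplus> (?b \<parallel> N))"
          by (simp add: y'' R4 4)
        moreover have "Resistor R4 \<oplus> (?b \<parallel> N) \<in> N11"
          using 4(1) 2(2,3) R4(2) unfolding N7_def N11_def by blast
        ultimately show ?thesis by blast
      next
        case (5 N)
        then obtain G1 N' where N: "N = Conductor G1 \<parallel> N'"
          unfolding N8_def by blast
        \<comment> \<open>The three-fold parallel connection of \<open>N12\<close> associates to the
          left, while \<open>N\<close> supplies \<open>Conductor G1\<close> and \<open>N'\<close>
          already joined.\<close>
        have "y = imp_at \<sigma> (Resistor R4 \<oplus> (?b \<parallel> Conductor G1 \<parallel> N'))"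
          by (simp add: y'' R4 5(2) N parallel_imp_assoc del: imp_at.simps(2))
        moreover have "Resistor R4 \<oplus> (?b \<parallel> Conductor G1 \<parallel> N') \<in> N12"
          using 5(1) 2(2,3) R4(2) unfolding N N8_def N12_def by blast
        ultimately show ?thesis by blast
      next
        case (6 N)
        then obtain G1 N' where N: "N = Conductor G1 \<parallel> N'"
          unfolding N9_def by blast
        have "y = imp_at \<sigma> (Resistor R4 \<oplus> (?b \<parallel> Conductor G1 \<parallel> N'))"
          by (simp add: y'' R4 6(2) N parallel_imp_assoc del: imp_at.simps(2))
        moreover have "Resistor R4 \<oplus> (?b \<parallel> Conductor G1 \<parallel> N') \<in> N13"
          using 6(1) 2(2,3) R4(2) unfolding N N9_def N13_def by blast
        ultimately show ?thesis by blast
      qed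
    qed
  qed
qed

text \<open>The branch with two inductors is the frequency inverse of an \<open>N4\<close> network,
  which is where the condition \<open>R2 > 0\<close> of \<open>N14\<close> comes from.\<close>

lemma RL2_RC1_ladder_realization:
  assumes \<sigma>: "\<sigma> > 0" and y: "y \<in> ladder (RC2 (1 / \<sigma>)) (RC1 \<sigma>)"
  shows "y \<in> RLC \<sigma> \<union> RC2 (1 / \<sigma>) \<union> imp_at \<sigma> ` N14"
proof -
  have inv: "1 / \<sigma> > 0"
    using \<sigma> by simp
  obtain r w x where y': "y = series_imp r (parallel_imp w x)"
    and rxw: "r \<in> resistive" "x \<in> RC1 \<sigma>" "w \<in> RC2 (1 / \<sigma>)"
    using y unfolding ladder_def by blast
  show ?thesis
  proof (cases "r = None")
    case True
    then show ?thesis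
      using None_in_RLC[OF \<sigma>] by (simp add: y')
  next
    case False
    then obtain R4 where R4: "r = imp_at \<sigma> (Resistor R4)" "R4 \<ge> 0"
      using rxw(1) by (auto simp: resistive_def)
    have "x \<in> RC1 (1 / (1 / \<sigma>))"
      using rxw(2) by simp
    with inv show ?thesis
    proof (cases rule: RL1_cases_parallel)
      case 1
      then show ?thesis
        unfolding y' parallel_imp_commute[of w] using inv rxw
        by (intro UnI1 UnI2 series_resistive_RC2 parallel_resistive_RC2)
    next
      case (2 g R5 L)
      \<comment> \<open>The case split was made at \<open>1 / \<sigma>\<close>, where an inductor
        \<open>L\<close> has the impedance of a capacitor \<open>1 / L\<close> at \<sigma>.\<close>
      define C1 b where "C1 = 1 / L" and "b = Resistor R5 \<oplus> Capacitor C1"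
      have C1: "C1 > 0"
        using 2 by (simp add: C1_def)
      have b_eq: "imp_at (1 / \<sigma>) (Resistor R5 \<oplus> Inductor L) = imp_at \<sigma> b"
        unfolding b_def C1_def by (simp flip: imp_at_freq_inv)
      have b: "imp_at \<sigma> b \<in> RC1 \<sigma>"
        using imp_at_class[OF \<sigma>, of b] 2 C1 by (simp add: imp_class_def b_def)
      define w' where "w' = parallel_imp g w"
      have y'': "y = series_imp r (parallel_imp (imp_at \<sigma> b) w')"
        unfolding y' 2(4) w'_def b_eq
        by (simp only: parallel_imp_assoc parallel_imp_commute[of w] parallel_imp_left_commute[of g])
      have "w' \<in> RC2 (1 / \<sigma>)"
        unfolding w'_def using inv 2(1) rxw(3) by (rule parallel_resistive_RC2)
      from RC2_realization[OF inv this] consider "w' \<in> RC1 (1 / \<sigma>)" | "w' \<in> imp_at (1 / \<sigma>) ` N4"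
        by blast
      then show ?thesis
      proof cases
        case 1
        have "y \<in> RLC \<sigma>"
          unfolding y'' using \<sigma> rxw(1) 1 b by (intro series_resistive_RLC parallel_RC1_RL1)
        then show ?thesis by simp
      next
        case w': 2
        then obtain N where N: "N \<in> N4" "w' = imp_at \<sigma> (freq_inv N)"
          by (auto simp: imp_at_freq_inv)
        have "y = imp_at \<sigma> (Resistor R4 \<oplus> (b \<parallel> freq_inv N))"
          by (simp add: y'' R4 N)
        moreover have "Resistor R4 \<oplus> (b \<parallel> freq_inv N) \<in> N14"
        proof -
          obtain R1 R2 G3 C C' where "R1 \<ge> 0" "R2 > 0" "G3 \<ge> 0" "C > 0" "C' > 0"
            "N = Resistor R1 \<oplus> (Capacitor C' \<parallel> (Resistor R2 \<oplus> (Conductor G3 \<parallel> Capacitor C)))"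
            using N(1) unfolding N4_def by blast
          then show ?thesis
            using 2(2) C1 R4(2) unfolding b_def N14_def by force
        qed
        ultimately show ?thesis by blast
      qed
    qed
  qed
qed

lemma RL2C_parallel_realization:
  assumes "\<sigma> > 0" "y \<in> RC2L_parallel (1 / \<sigma>)"
  shows "y \<in> RLC \<sigma> \<union> RC2 (1 / \<sigma>) \<union> imp_at \<sigma> ` (N10 \<union> N11 \<union> N12 \<union> N13 \<union> N14)"
  using assms RL1_RLC_ladder_realization[OF assms(1), of y] RL2_RC1_ladder_realization[OF assms(1), of y]
  unfolding RC2L_parallel_def by (auto simp: RLC_inverse)

lemma N10_14_counts:
  "N \<in> N10 \<union> N11 \<union> N12 \<union> N13 \<union> N14 \<Longrightarrow> series_parallel N \<and> num_storage N \<le> 3"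
  by (elim UnE)
    (auto simp: num_storage_def N10_def N11_def N12_def N13_def N14_def)

text \<open>A ladder at \<sigma> is a mirrored ladder evaluated at \<open>1 / \<sigma>\<close>,
  which yields the inverted networks; the reciprocal of a mirrored ladder at \<sigma> yields the
  dual ones.\<close>

lemma RC2L_realization:
  assumes "\<sigma> > 0" "z \<in> RC2L \<sigma>"
  shows "z \<in> RLC \<sigma> \<union> RC2 \<sigma> \<union> imp_at \<sigma> `
    (freq_inv ` (N10 \<union> N11 \<union> N12 \<union> N13 \<union> N14) \<union> dual ` (N10 \<union> N11 \<union> N12 \<union> N13 \<union> N14))"
proof -
  let ?\<N> = "N10 \<union> N11 \<union> N12 \<union> N13 \<union> N14"
  consider "z \<in> RC2L_parallel \<sigma>" | y where "y \<in> RC2L_parallel (1 / \<sigma>)" "z = reciprocal y"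
    using assms(2) unfolding RC2L_def by blast
  then show ?thesis
  proof cases
    case 1
    then have "z \<in> RLC (1 / \<sigma>) \<union> RC2 (1 / (1 / \<sigma>)) \<union> imp_at (1 / \<sigma>) ` ?\<N>"
      using assms(1) by (intro RL2C_parallel_realization) simp_all
    then show ?thesis
      unfolding imp_at_inverse_image RLC_inverse[OF assms(1)] by auto
  next
    case (2 y)
    from RL2C_parallel_realization[OF assms(1) 2(1)]
    consider "y \<in> RLC \<sigma>" | "y \<in> RC2 (1 / \<sigma>)" | N where "N \<in> ?\<N>" "y = imp_at \<sigma> N"
      by blast
    then show ?thesis
    proof cases
      case 1
      then show ?thesis
        using reciprocal_RLC[OF assms(1)] 2(2) by blast
    next
      case y: 2
      then have "z \<in> RC2 (1 / (1 / \<sigma>))"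
        using reciprocal_RC2[of "1 / \<sigma>" y] assms(1) 2(2) by simp
      then show ?thesis by simp
    next
      case (3 N)
      then have "z = imp_at \<sigma> (dual N)"
        using imp_at_dual[OF assms(1), of N] N10_14_counts[OF 3(1)] 2(2) by simp
      then show ?thesis
        using 3(1) by blast
    qed
  qed
qed

section \<open>Element counts and the generating set\<close>

lemma freq_inv_counts:
  "series_parallel N \<Longrightarrow> series_parallel (freq_inv N)" "num_storage (freq_inv N) = num_storage N"
  by (induction N) (auto simp: num_storage_def)

lemma dual_counts:
  "series_parallel N \<Longrightarrow> series_parallel (dual N)" "num_storage (dual N) = num_storage N"
  by (induction N) (auto simp: num_storage_def)

lemma N1_9_counts:
  "N \<in> N1 \<union> N2 \<union> N3 \<union> N4 \<union> N6 \<union> N7 \<union> N8 \<union> N9 \<Longrightarrow> series_parallel N \<and> num_storage N \<le> 3"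
  by (elim UnE)
    (auto simp: num_storage_def N1_def N2_def N3_def N4_def N6_def N7_def N8_def N9_def)

theorem theorem16:
  shows "generating_set
    (N1 \<union> N2 \<union> N3 \<union> N4 \<union> N6 \<union> N7 \<union> N8 \<union> N9
      \<union> freq_inv ` N10 \<union> freq_inv ` N11 \<union> freq_inv ` N12 \<union> freq_inv ` N13 \<union> freq_inv ` N14
      \<union> dual ` N10 \<union> dual ` N11 \<union> dual ` N12 \<union> dual ` N13 \<union> dual ` N14)
    2 1" (is "generating_set ?\<G> 2 1")
proof -
  define \<L> \<N> where "\<L> = N1 \<union> N2 \<union> N3 \<union> N4 \<union> N6 \<union> N7 \<union> N8 \<union> N9"
    and "\<N> = N10 \<union> N11 \<union> N12 \<union> N13 \<union> N14"
  have \<G>: "?\<G> = \<L> \<union> (freq_inv ` \<N> \<union> dual ` \<N>)"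
    unfolding \<L>_def \<N>_def image_Un Un_assoc ..
  have low: "N1 \<union> N2 \<subseteq> \<L>" "N1 \<union> N3 \<subseteq> \<L>" "N4 \<subseteq> \<L>" "N6 \<union> N7 \<union> N8 \<union> N9 \<subseteq> \<L>"
    unfolding \<L>_def by auto
  show ?thesis
    unfolding generating_set_def \<G>
  proof (rule conjI; rule ballI)
    fix N assume "N \<in> \<L> \<union> (freq_inv ` \<N> \<union> dual ` \<N>)"
    then consider "N \<in> \<L>" | M where "M \<in> \<N>" "N = freq_inv M \<or> N = dual M"
      by blast
    then show "series_parallel N \<and> num_storage N \<le> 2 + 1"
    proof cases
      case 1
      then show ?thesis
        using N1_9_counts unfolding \<L>_def by simp
    next
      case 2
      then show ?thesis
        using N10_14_counts[of M] freq_inv_counts[of M] dual_counts[of M] unfolding \<N>_def by auto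
    qed
  next
    fix Z assume "Z \<in> impedances 2 1"
    then obtain N where N: "series_parallel N" "num_capacitors N \<le> 2" "num_inductors N \<le> 1"
      and Z: "impedance N = Some Z"
      unfolding impedances_def by blast
    note pos = var_pos
    have "Some Z \<in> imp_class var (num_capacitors N) (num_inductors N)"
      using imp_at_class[OF pos N(1)] Z by (simp add: imp_at_var)
    moreover have "num_capacitors N = 0 \<or> num_capacitors N = 1 \<or> num_capacitors N = 2"
      "num_inductors N = 0 \<or> num_inductors N = 1"
      using N by linarith+
    ultimately have "Some Z \<in> resistive \<union> RC1 var \<union> RC1 (1 / var) \<union> RC2 var \<union> RLC var \<union> RC2L var"
      by (auto simp: imp_class_def)
    \<comment> \<open>Each realization lemma yields a network or falls back on a class with fewer
      elements, so they are applied from the largest class downwards. The open-circuit alternative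
      at the end is void for \<open>Some Z\<close>.\<close>
    then have "Some Z \<in> RC1 var \<union> RC1 (1 / var) \<union> RC2 var \<union> RLC var
        \<union> imp_at var ` (freq_inv ` \<N> \<union> dual ` \<N>)"
      using resistive_subset_RC1[OF pos] RC2L_realization[OF pos, of "Some Z", folded \<N>_def] by blast
    then have "Some Z \<in> RC1 var \<union> RC1 (1 / var) \<union> imp_at var ` (\<L> \<union> (freq_inv ` \<N> \<union> dual ` \<N>))"
      using RC2_realization[OF pos, of "Some Z"] RLC_realization[OF pos, of "Some Z"] low(3,4) by blast
    then have "Some Z \<in> imp_at var ` (\<L> \<union> (freq_inv ` \<N> \<union> dual ` \<N>))"
      using RC1_realization[OF pos, of "Some Z"] RL1_realization[OF pos, of "Some Z"] low(1,2) by blast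
    then show "\<exists>N\<in>\<L> \<union> (freq_inv ` \<N> \<union> dual ` \<N>). impedance N = Some Z"
      unfolding imp_at_var image_iff by metis
  qed
qed

end
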